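(* Let $(r,\Lambda,A)$ be an admissible triple with $\Lambda\neq\{1\}$. Let $G$ be a subgroup of $\mathrm{V}(r,\mathbb R^*_+,\mathbb R)$ such that $$G\cap \mathrm{F}(r,\mathbb R^*_+,\mathbb R)=\mathrm{F}(r,\Lambda,A).$$ Then the group $G$ (in the pure group signature) interprets the Arithmetic $(\mathbb N,+,\times)$ with parameters.
   Context: An admissible triple $(r,\Lambda,A)$ consists of a real $r>0$, a subgroup $\Lambda$ of the multiplicative group $\mathbb R^*_+$ of positive reals, and an additive subgroup $A\subseteq\mathbb R$ with $r\in A$ and $\lambda A\subseteq A$ for all $\lambda\in\Lambda$. Maps act on the right: $(\alpha)x$, and $(\alpha)(xy)=((\alpha)x)y$. $\mathrm{V}(r,\Lambda,A)$ is the group of all bijections $x\colon[0,r)\to[0,r)$ that are piecewise affine with finitely many cuts and singular points (breakpoints), right-continuous at every point, whose affine pieces all have slopes in $\Lambda$, and such that all cut and singular points and their images lie in $A$. $\mathrm{F}(r,\Lambda,A)$ is the subgroup of elements of $\mathrm{V}(r,\Lambda,A)$ continuous for the usual topology of $[0,r)$; $\mathrm{T}(r,\Lambda,A)$ is the subgroup of elements continuous for the circle topology on $[0,r)$ (identifying $[0,r)$ with $[0,r]/\{0,r\}$). An interpretation of a structure $M$ in a structure $N$ with parameters is a pair $(n,f)$ with $n\in\mathbb N$ and $f$ a surjection from a subset of $N^n$ onto $M$ such that for every set $X$ definable in $M$ without parameters (in any $M^k$), the preimage of $X$ under the induced map on $k$-tuples is first-order definable in $N$ using parameters from $N$; it is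 an interpretation without parameters if these preimages are definable without parameters. *)

theory Defs
  imports Complex_Main
begin

definition mult_subgroup :: "real set \<Rightarrow> bool" where
  "mult_subgroup L \<longleftrightarrow> L \<subseteq> {0<..} \<and> 1 \<in> L \<and>
     (\<forall>a\<in>L. \<forall>b\<in>L. a * b \<in> L) \<and> (\<forall>a\<in>L. inverse a \<in> L)"

definition add_subgroup :: "real set \<Rightarrow> bool" where
  "add_subgroup A \<longleftrightarrow> 0 \<in> A \<and> (\<forall>a\<in>A. \<forall>b\<in>A. a + b \<in> A) \<and> (\<forall>a\<in>A. - a \<in> A)"

definition admissible :: "real \<Rightarrow> real set \<Rightarrow> real set \<Rightarrow> bool" where
  "admissible r L A \<longleftrightarrow> r > 0 \<and> mult_subgroup L \<and> add_subgroup A \<and> r \<in> A \<and>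
     (\<forall>l\<in>L. \<forall>a\<in>A. l * a \<in> A)"

text \<open>Elements of V(r,L,A) are represented as maps real => real that are the identity
  outside [0,r). A map is piecewise affine w.r.t. a subdivision 0 = p_0 < ... < p_n = r
  with all p_i in A, affine with slope in L on each [p_i, p_(i+1)) (hence right-continuous),
  and with all images x(p_i) in A.\<close>

definition Vset :: "real \<Rightarrow> real set \<Rightarrow> real set \<Rightarrow> (real \<Rightarrow> real) set" where
  "Vset r L A = {x. (\<forall>t. t \<notin> {0..<r} \<longrightarrow> x t = t) \<and> bij_betw x {0..<r} {0..<r} \<and>
     (\<exists>ps::real list. length ps \<ge> 2 \<and> sorted_wrt (<) ps \<and> hd ps = 0 \<and> last ps = r \<and>
        set ps \<subseteq> A \<and>
        (\<forall>i. Suc i < length ps \<longrightarrow> x (ps ! i) \<in> A \<and>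
           (\<exists>l\<in>L. \<exists>b. \<forall>t\<in>{ps ! i..<ps ! Suc i}. x t = l * t + b)))}"

definition Fset :: "real \<Rightarrow> real set \<Rightarrow> real set \<Rightarrow> (real \<Rightarrow> real) set" where
  "Fset r L A = {x \<in> Vset r L A. continuous_on {0..<r} x}"

text \<open>Maps act on the right: the product xy is "first x, then y", i.e. y o x.\<close>

definition Vmult :: "(real \<Rightarrow> real) \<Rightarrow> (real \<Rightarrow> real) \<Rightarrow> (real \<Rightarrow> real)" where
  "Vmult x y = y \<circ> x"

definition is_subgroup_of :: "(real \<Rightarrow> real) set \<Rightarrow> (real \<Rightarrow> real) set \<Rightarrow> bool" where
  "is_subgroup_of G H \<longleftrightarrow> G \<subseteq> H \<and> id \<in> G \<and> (\<forall>x\<in>G. \<forall>y\<in>G. Vmult x y \<in> G) \<and>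
     (\<forall>x\<in>G. inv x \<in> G)"

datatype gterm = GVar nat | GOne | GMul gterm gterm | GInv gterm

datatype gform = GEq gterm gterm | GNot gform | GAnd gform gform | GEx nat gform

fun geval :: "('a \<Rightarrow> 'a \<Rightarrow> 'a) \<Rightarrow> ('a \<Rightarrow> 'a) \<Rightarrow> 'a \<Rightarrow> (nat \<Rightarrow> 'a) \<Rightarrow> gterm \<Rightarrow> 'a" where
  "geval m i e v (GVar n) = v n"
| "geval m i e v GOne = e"
| "geval m i e v (GMul s t) = m (geval m i e v s) (geval m i e v t)"
| "geval m i e v (GInv s) = i (geval m i e v s)"

fun gsat :: "'a set \<Rightarrow> ('a \<Rightarrow> 'a \<Rightarrow> 'a) \<Rightarrow> ('a \<Rightarrow> 'a) \<Rightarrow> 'a \<Rightarrow> (nat \<Rightarrow> 'a) \<Rightarrow> gform \<Rightarrow> bool" where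
  "gsat G m i e v (GEq s t) = (geval m i e v s = geval m i e v t)"
| "gsat G m i e v (GNot f) = (\<not> gsat G m i e v f)"
| "gsat G m i e v (GAnd f g) = (gsat G m i e v f \<and> gsat G m i e v g)"
| "gsat G m i e v (GEx n f) = (\<exists>a\<in>G. gsat G m i e (v(n := a)) f)"

fun gtvars :: "gterm \<Rightarrow> nat set" where
  "gtvars (GVar n) = {n}"
| "gtvars GOne = {}"
| "gtvars (GMul s t) = gtvars s \<union> gtvars t"
| "gtvars (GInv s) = gtvars s"

fun gfv :: "gform \<Rightarrow> nat set" where
  "gfv (GEq s t) = gtvars s \<union> gtvars t"
| "gfv (GNot f) = gfv f"
| "gfv (GAnd f g) = gfv f \<union> gfv g"
| "gfv (GEx n f) = gfv f - {n}"

definition gdefinable_params ::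
  "'a set \<Rightarrow> ('a \<Rightarrow> 'a \<Rightarrow> 'a) \<Rightarrow> ('a \<Rightarrow> 'a) \<Rightarrow> 'a \<Rightarrow> nat \<Rightarrow> 'a list set \<Rightarrow> bool" where
  "gdefinable_params G m i e k S \<longleftrightarrow>
     (\<exists>\<phi> ps. set ps \<subseteq> G \<and> gfv \<phi> \<subseteq> {..<k + length ps} \<and>
        S = {xs. length xs = k \<and> set xs \<subseteq> G \<and>
               gsat G m i e (\<lambda>n. if n < k then xs ! n else if n < k + length ps then ps ! (n - k) else e) \<phi>})"

datatype aterm = AVar nat | APlus aterm aterm | ATimes aterm aterm

datatype aform = AEq aterm aterm | ANot aform | AAnd aform aform | AEx nat aform

fun aeval :: "(nat \<Rightarrow> nat) \<Rightarrow> aterm \<Rightarrow> nat" where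
  "aeval v (AVar n) = v n"
| "aeval v (APlus s t) = aeval v s + aeval v t"
| "aeval v (ATimes s t) = aeval v s * aeval v t"

fun asat :: "(nat \<Rightarrow> nat) \<Rightarrow> aform \<Rightarrow> bool" where
  "asat v (AEq s t) = (aeval v s = aeval v t)"
| "asat v (ANot f) = (\<not> asat v f)"
| "asat v (AAnd f g) = (asat v f \<and> asat v g)"
| "asat v (AEx n f) = (\<exists>a. asat (v(n := a)) f)"

fun atvars :: "aterm \<Rightarrow> nat set" where
  "atvars (AVar n) = {n}"
| "atvars (APlus s t) = atvars s \<union> atvars t"
| "atvars (ATimes s t) = atvars s \<union> atvars t"

fun afv :: "aform \<Rightarrow> nat set" where
  "afv (AEq s t) = atvars s \<union> atvars t"
| "afv (ANot f) = afv f"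
| "afv (AAnd f g) = afv f \<union> afv g"
| "afv (AEx n f) = afv f - {n}"

definition arith_definable :: "nat \<Rightarrow> nat list set \<Rightarrow> bool" where
  "arith_definable k X \<longleftrightarrow>
     (\<exists>\<phi>. afv \<phi> \<subseteq> {..<k} \<and> X = {ns. length ns = k \<and> asat (\<lambda>n. if n < k then ns ! n else 0) \<phi>})"

text \<open>(n, f): f is a surjection from D \<subseteq> G^n onto N such that for every k and every
  parameter-free definable X \<subseteq> N^k, the preimage in (G^n)^k = G^(n*k) (tuples of n-tuples
  concatenated) is definable in G with parameters.\<close>

definition interprets_arith_params ::
  "'a set \<Rightarrow> ('a \<Rightarrow> 'a \<Rightarrow> 'a) \<Rightarrow> ('a \<Rightarrow> 'a) \<Rightarrow> 'a \<Rightarrow> bool" where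
  "interprets_arith_params G m i e \<longleftrightarrow>
     (\<exists>(n::nat) (D::'a list set) (f::'a list \<Rightarrow> nat).
        D \<subseteq> {xs. length xs = n \<and> set xs \<subseteq> G} \<and> f ` D = UNIV \<and>
        (\<forall>k X. arith_definable k X \<longrightarrow>
           gdefinable_params G m i e (n * k)
             {concat ds | ds. length ds = k \<and> set ds \<subseteq> D \<and> map f ds \<in> X}))"

end

theory Submission
  imports Defs "HOL-Library.Groups_Big_Fun"
begin

text \<open>
  Natural numbers are coded as powers of one element. For a concave one-bump map \<open>f\<close> on \<open>[0,r)\<close>
  with two kinks, every \<open>g\<close> commuting with \<open>f\<close> is affine near both ends, determined by the image of
  one point, and sends the first kink into the \<open>f\<close>-orbits of the two kinks. Hence the centralizer of
  \<open>f\<close> in \<open>G\<close> is infinite cyclic, say generated by \<open>F\<close>, and \<open>n\<close> is coded by \<open>F\<^sup>n\<close>; the sign of \<open>n\<close> is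
  recognised by letting \<open>F\<^bsup>-n\<^esup>\<close> move the support \<open>(0,p)\<close> of a bump \<open>h\<close> and asking whether the result
  commutes with a bump \<open>a\<close> supported on the fundamental domain \<open>(p, F p)\<close>.

  For multiplication let \<open>t\<close> be conjugation by \<open>F\<close> and consider an abelian definable \<open>t\<close>-invariant
  subgroup containing \<open>a\<close>, whose elements fix all \<open>F\<^sup>i p\<close>. Written additively, \<open>z = n k\<close> holds iff
  there are \<open>u\<close>, \<open>s\<close>, \<open>w\<close> in it with \<open>(t\<^sup>z - 1) a = (t\<^sup>n - 1) u\<close>, \<open>(t\<^sup>k - 1) a = (t - 1) s\<close> and
  \<open>u - s = (t - 1) w\<close>. For the nontrivial direction, attach to an element the finitely supported
  sequence of logarithms of its right slopes at the points \<open>F\<^sup>i p\<close> and compare the sums and first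
  moments of these sequences.
\<close>

subsection \<open>Coding arithmetic by formulas of group theory\<close>

fun trename :: "(nat \<Rightarrow> nat) \<Rightarrow> gterm \<Rightarrow> gterm" where
  "trename \<pi> (GVar n) = GVar (\<pi> n)"
| "trename \<pi> GOne = GOne"
| "trename \<pi> (GMul s t) = GMul (trename \<pi> s) (trename \<pi> t)"
| "trename \<pi> (GInv s) = GInv (trename \<pi> s)"

fun frename :: "(nat \<Rightarrow> nat) \<Rightarrow> gform \<Rightarrow> gform" where
  "frename \<pi> (GEq s t) = GEq (trename \<pi> s) (trename \<pi> t)"
| "frename \<pi> (GNot f) = GNot (frename \<pi> f)"
| "frename \<pi> (GAnd f g) = GAnd (frename \<pi> f) (frename \<pi> g)"
| "frename \<pi> (GEx n f) = GEx (\<pi> n) (frename \<pi> f)"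

lemma geval_trename: "geval m i e v (trename \<pi> t) = geval m i e (v \<circ> \<pi>) t"
  by (induction t) auto

text \<open>Bound variables are renamed along with the free ones. Injectivity excludes capture: an
  update at \<open>\<pi> n\<close> must be seen through \<open>\<pi>\<close> at \<open>n\<close>
  alone.\<close>

lemma gsat_frename:
  assumes "inj \<pi>"
  shows "gsat G m i e v (frename \<pi> \<phi>) = gsat G m i e (v \<circ> \<pi>) \<phi>"
proof (induction \<phi> arbitrary: v)
  case (GEx n \<phi>)
  have "v(\<pi> n := a) \<circ> \<pi> = (v \<circ> \<pi>)(n := a)" for a
    using assms by (auto simp: inj_def)
  with GEx show ?case by (simp only: frename.simps gsat.simps)
qed (auto simp: geval_trename)

lemma gtvars_trename: "gtvars (trename \<pi> t) = \<pi> ` gtvars t"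
  by (induction t) auto

lemma gfv_frename: "inj \<pi> \<Longrightarrow> gfv (frename \<pi> \<phi>) = \<pi> ` gfv \<phi>"
  by (induction \<phi>) (auto simp: gtvars_trename inj_def)

text \<open>Variables 0, 1, 2 hold the parameters, the arithmetic variable \<open>j\<close> becomes \<open>j + 3\<close>, and the
  last argument of a formula builder is a bound above which all variables are fresh.\<close>

definition comm_form :: "gterm \<Rightarrow> gterm \<Rightarrow> gform" where
  "comm_form s t = GEq (GMul s t) (GMul t s)"

definition conj_term :: "gterm \<Rightarrow> gterm \<Rightarrow> gterm" where
  "conj_term g x = GMul (GMul (GInv g) x) g"

definition cent_form :: "nat \<Rightarrow> nat \<Rightarrow> gform" where
  "cent_form x m = GNot (GEx m (GAnd (comm_form (GVar m) (GVar 0))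
     (GNot (comm_form (GVar x) (conj_term (GVar m) (GVar 1))))))"

definition base_form :: "nat \<Rightarrow> nat \<Rightarrow> gform" where
  "base_form x m = GAnd (cent_form x m)
     (GNot (GEx m (GAnd (cent_form m (Suc m)) (GNot (comm_form (GVar x) (GVar m))))))"

definition nat_form :: "nat \<Rightarrow> gform" where
  "nat_form y = GAnd (comm_form (GVar y) (GVar 0))
     (comm_form (conj_term (GInv (GVar y)) (GVar 2)) (GVar 1))"

text \<open>The variables \<open>m\<close>, \<open>m + 1\<close>, \<open>m + 2\<close> stand for u,
  s, w. In the three equations every difference is cleared by moving the negative terms to the other
  side, so only products in an abelian group occur.\<close>

definition mult_form :: "nat \<Rightarrow> nat \<Rightarrow> nat \<Rightarrow> nat \<Rightarrow> gform" where
  "mult_form z n k m = GEx m (GEx (m + 1) (GEx (m + 2)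
     (GAnd (base_form m (m + 3)) (GAnd (base_form (m + 1) (m + 3)) (GAnd (base_form (m + 2) (m + 3))
     (GAnd (GEq (GMul (conj_term (GVar z) (GVar 1)) (GVar m))
                (GMul (conj_term (GVar n) (GVar m)) (GVar 1)))
     (GAnd (GEq (GMul (conj_term (GVar k) (GVar 1)) (GVar (m + 1)))
                (GMul (conj_term (GVar 0) (GVar (m + 1))) (GVar 1)))
           (GEq (GMul (GVar m) (GVar (m + 2)))
                (GMul (GVar (m + 1)) (conj_term (GVar 0) (GVar (m + 2))))))))))))"

text \<open>Arithmetic terms have no counterpart among group terms, so a formula states that
  \<open>y\<close> codes the value. Addition becomes the product of codes. In the multiplicative
  case \<open>nat_form y\<close> comes first, because \<open>mult_form\<close> is interpreted on
  codes only.\<close>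

fun value_form :: "aterm \<Rightarrow> nat \<Rightarrow> nat \<Rightarrow> gform" where
  "value_form (AVar j) y m = GEq (GVar y) (GVar (j + 3))"
| "value_form (APlus s t) y m = GEx m (GEx (m + 1)
     (GAnd (value_form s m (m + 2)) (GAnd (value_form t (m + 1) (m + 2))
       (GEq (GVar y) (GMul (GVar m) (GVar (m + 1)))))))"
| "value_form (ATimes s t) y m = GEx m (GEx (m + 1)
     (GAnd (value_form s m (m + 2)) (GAnd (value_form t (m + 1) (m + 2))
       (GAnd (nat_form y) (mult_form y m (m + 1) (m + 2))))))"

fun var_bound :: "aterm \<Rightarrow> nat" where
  "var_bound (AVar j) = j + 4"
| "var_bound (APlus s t) = max (var_bound s) (var_bound t)"
| "var_bound (ATimes s t) = max (var_bound s) (var_bound t)"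

fun translate :: "aform \<Rightarrow> gform" where
  "translate (AEq s t) = (let m = max (var_bound s) (var_bound t) in
     GEx m (GAnd (value_form s m (Suc m)) (value_form t m (Suc m))))"
| "translate (ANot f) = GNot (translate f)"
| "translate (AAnd f g) = GAnd (translate f) (translate g)"
| "translate (AEx n f) = GEx (n + 3) (GAnd (nat_form (n + 3)) (translate f))"

fun nats_form :: "nat \<Rightarrow> gform" where
  "nats_form 0 = GEq GOne GOne"
| "nats_form (Suc k) = GAnd (nat_form (k + 3)) (nats_form k)"

lemma var_bound: "j \<in> atvars t \<Longrightarrow> j + 3 < var_bound t" "4 \<le> var_bound t"
  by (induction t) (auto simp: less_max_iff_disj)

lemma gfv_value_form:
  "y < m \<Longrightarrow> var_bound t \<le> m \<Longrightarrow>
   gfv (value_form t y m) \<subseteq> {0,1,2,y} \<union> (\<lambda>j. j + 3) ` atvars t"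
proof (induction t arbitrary: y m)
  case (APlus s t)
  then have "gfv (value_form s m (m + 2)) \<subseteq> {0,1,2,m} \<union> (\<lambda>j. j + 3) ` atvars s"
    "gfv (value_form t (m+1) (m + 2)) \<subseteq> {0,1,2,m+1} \<union> (\<lambda>j. j + 3) ` atvars t"
    by auto
  then show ?case by auto
next
  case (ATimes s t)
  then have "gfv (value_form s m (m + 2)) \<subseteq> {0,1,2,m} \<union> (\<lambda>j. j + 3) ` atvars s"
    "gfv (value_form t (m+1) (m + 2)) \<subseteq> {0,1,2,m+1} \<union> (\<lambda>j. j + 3) ` atvars t"
    by auto
  moreover have "gfv (mult_form y m (m + 1) (m + 2)) \<subseteq> {0,1,2,y,m,m+1}"
    and "gfv (nat_form y) \<subseteq> {0,1,2,y}"
    by (auto simp: mult_form_def base_form_def cent_form_def comm_form_def conj_term_def nat_form_def)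
  ultimately show ?case by auto
qed auto

lemma gfv_translate: "gfv (translate \<phi>) \<subseteq> {0,1,2} \<union> (\<lambda>j. j + 3) ` afv \<phi>"
proof (induction \<phi>)
  case (AEq s t)
  define m where "m = max (var_bound s) (var_bound t)"
  have "gfv (value_form s m (Suc m)) \<subseteq> {0,1,2,m} \<union> (\<lambda>j. j + 3) ` atvars s"
    "gfv (value_form t m (Suc m)) \<subseteq> {0,1,2,m} \<union> (\<lambda>j. j + 3) ` atvars t"
    by (rule gfv_value_form; simp add: m_def)+
  then show ?case by (auto simp: Let_def m_def[symmetric])
next
  case (AEx n f)
  then show ?case
    by (auto simp: nat_form_def comm_form_def conj_term_def)
qed auto

lemma gfv_nats_form: "gfv (nats_form k) \<subseteq> {0,1,2} \<union> (\<lambda>j. j + 3) ` {..<k}"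
  by (induction k) (auto simp: nat_form_def comm_form_def conj_term_def)

text \<open>This is the interface between logic and dynamics: \<open>cj\<close>, \<open>Cent\<close>
  and \<open>Base\<close> are the meanings of \<open>conj_term\<close>, \<open>cent_form\<close> and
  \<open>base_form\<close>, and the assumptions are what the group must supply for the translation
  to be correct. The parameters c0, c1, c2 will be \<open>F\<close>, \<open>a\<close>,
  \<open>h\<close>.\<close>

locale coded_naturals =
  fixes G :: "'a set" and m :: "'a \<Rightarrow> 'a \<Rightarrow> 'a" and i :: "'a \<Rightarrow> 'a" and e c0 c1 c2 :: 'a
    and num :: "nat \<Rightarrow> 'a"
  fixes cj :: "'a \<Rightarrow> 'a \<Rightarrow> 'a" and Cent :: "'a \<Rightarrow> bool" and Base :: "'a \<Rightarrow> bool"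
  defines "cj \<equiv> \<lambda>g x. m (m (i g) x) g"
    and "Cent \<equiv> \<lambda>x. \<forall>g\<in>G. m g c0 = m c0 g \<longrightarrow> m x (cj g c1) = m (cj g c1) x"
    and "Base \<equiv> \<lambda>x. Cent x \<and> (\<forall>y\<in>G. Cent y \<longrightarrow> m x y = m y x)"
  assumes params: "c0 \<in> G" "c1 \<in> G" "c2 \<in> G"
    and num: "num n \<in> G" "inj num" "num (k + l) = m (num k) (num l)"
    and nat_iff: "y \<in> G \<Longrightarrow> (m y c0 = m c0 y \<and> m (cj (i y) c2) c1 = m c1 (cj (i y) c2)) \<longleftrightarrow> y \<in> range num"
    and mult_iff: "(\<exists>u\<in>G. \<exists>s\<in>G. \<exists>w\<in>G. Base u \<and> Base s \<and> Base w \<and>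
       m (cj (num j) c1) u = m (cj (num k) u) c1 \<and> m (cj (num l) c1) s = m (cj c0 s) c1 \<and>
       m u w = m s (cj c0 w)) \<longleftrightarrow> j = k * l"
begin

abbreviation sat :: "(nat \<Rightarrow> 'a) \<Rightarrow> gform \<Rightarrow> bool" where
  "sat \<equiv> gsat G m i e"

definition param_val :: "(nat \<Rightarrow> 'a) \<Rightarrow> bool" where
  "param_val v \<longleftrightarrow> v 0 = c0 \<and> v 1 = c1 \<and> v 2 = c2"

lemma param_val_upd [simp]: "3 \<le> n \<Longrightarrow> param_val (v(n := a)) = param_val v"
  by (auto simp: param_val_def)

lemma sat_cent: 
  "param_val v \<Longrightarrow> 3 \<le> k \<Longrightarrow> x < k \<Longrightarrow> sat v (cent_form x k) \<longleftrightarrow> Cent (v x)"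
  by (auto simp: param_val_def cent_form_def comm_form_def conj_term_def Cent_def cj_def)

lemma sat_base:
  "param_val v \<Longrightarrow> 3 \<le> k \<Longrightarrow> x < k \<Longrightarrow> sat v (base_form x k) \<longleftrightarrow> Base (v x)"
  by (auto simp: base_form_def sat_cent Base_def comm_form_def)

lemma sat_nat:
  "param_val v \<Longrightarrow> v y \<in> G \<Longrightarrow> sat v (nat_form y) \<longleftrightarrow> v y \<in> range num"
  by (subst nat_iff[symmetric])
     (auto simp: nat_form_def comm_form_def conj_term_def cj_def param_val_def)

lemma sat_mult:
  assumes "param_val v" "3 \<le> m'" "y < m'" "k < m'" "l < m'" "v y = num j" "v k = num a" "v l = num b"
  shows "sat v (mult_form y k l m') \<longleftrightarrow> j = a * b"
proof -
  have v: "v 0 = c0" "v (Suc 0) = c1" using assms(1) by (auto simp: param_val_def)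
  show ?thesis
    unfolding mult_iff[of j a b, symmetric]
    using assms v by (simp add: mult_form_def sat_base conj_term_def cj_def)
qed

lemma sat_value:
  "param_val v \<Longrightarrow> y < k \<Longrightarrow> var_bound t \<le> k \<Longrightarrow> v y \<in> G \<Longrightarrow> (\<And>j. j \<in> atvars t \<Longrightarrow> v (j + 3) = num (\<nu> j)) \<Longrightarrow>
   sat v (value_form t y k) \<longleftrightarrow> v y = num (aeval \<nu> t)"
proof (induction t arbitrary: v y k)
  case (APlus s t)
  have k4: "4 \<le> k" using APlus.prems(3) var_bound(2)[of s] by simp
  have vs: "j + 3 < k" if "j \<in> atvars s \<union> atvars t" for j
    using that var_bound(1)[of j s] var_bound(1)[of j t] APlus.prems(3) by auto
  have upd: "(v(k := a, Suc k := b)) (j + 3) = num (\<nu> j)" if "j \<in> atvars s \<union> atvars t" for a b j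
    using vs[OF that] APlus.prems(5) that by auto
  have s: "sat (v(k := a, Suc k := b)) (value_form s k (k + 2)) \<longleftrightarrow> a = num (aeval \<nu> s)"
    if "a \<in> G" for a b
    by (subst APlus.IH(1)) (use APlus.prems upd k4 that in auto)
  have t: "sat (v(k := a, Suc k := b)) (value_form t (Suc k) (k + 2)) \<longleftrightarrow> b = num (aeval \<nu> t)"
    if "b \<in> G" for a b
    by (subst APlus.IH(2)) (use APlus.prems upd k4 that in auto)
  show ?case
    using APlus.prems s t num by auto
next
  case (ATimes s t)
  have k4: "4 \<le> k" using ATimes.prems(3) var_bound(2)[of s] by simp
  have vs: "j + 3 < k" if "j \<in> atvars s \<union> atvars t" for j
    using that var_bound(1)[of j s] var_bound(1)[of j t] ATimes.prems(3) by auto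
  have upd: "(v(k := a, Suc k := b)) (j + 3) = num (\<nu> j)" if "j \<in> atvars s \<union> atvars t" for a b j
    using vs[OF that] ATimes.prems(5) that by auto
  have s: "sat (v(k := a, Suc k := b)) (value_form s k (k + 2)) \<longleftrightarrow> a = num (aeval \<nu> s)"
    if "a \<in> G" for a b
    by (subst ATimes.IH(1)) (use ATimes.prems upd k4 that in auto)
  have t: "sat (v(k := a, Suc k := b)) (value_form t (Suc k) (k + 2)) \<longleftrightarrow> b = num (aeval \<nu> t)"
    if "b \<in> G" for a b
    by (subst ATimes.IH(2)) (use ATimes.prems upd k4 that in auto)
  have nat: "sat (v(k := c, Suc k := c')) (nat_form y) \<longleftrightarrow> v y \<in> range num" for c c'
    by (subst sat_nat) (use ATimes.prems k4 in auto)
  have mu: "sat (v(k := num a, Suc k := num b)) (mult_form y k (Suc k) (k + 2)) \<longleftrightarrow> j = a * b"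
    if "v y = num j" for a b j
    by (rule sat_mult) (use ATimes.prems k4 that in auto)
  show ?case
    using s t nat mu num(1) by auto
qed auto

lemma sat_translate:
  "param_val v \<Longrightarrow> (\<And>j. j \<in> afv \<phi> \<Longrightarrow> v (j + 3) = num (\<nu> j)) \<Longrightarrow>
   sat v (translate \<phi>) \<longleftrightarrow> asat \<nu> \<phi>"
proof (induction \<phi> arbitrary: v \<nu>)
  case (AEq s t)
  define k where "k = max (var_bound s) (var_bound t)"
  have k4: "4 \<le> k" using var_bound(2)[of s] unfolding k_def by simp
  have vs: "j + 3 < k" if "j \<in> atvars s \<union> atvars t" for j
    using that var_bound(1)[of j s] var_bound(1)[of j t] unfolding k_def by auto
  have upd: "(v(k := a)) (j + 3) = num (\<nu> j)" if "j \<in> atvars s \<union> atvars t" for a j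
    using vs[OF that] AEq.prems(2) that by auto
  have s: "sat (v(k := a)) (value_form s k (Suc k)) \<longleftrightarrow> a = num (aeval \<nu> s)"
    if "a \<in> G" for a
    by (subst sat_value[where \<nu> = \<nu>]) (use AEq.prems(1) upd k4 that in \<open>auto simp: k_def\<close>)
  have t: "sat (v(k := a)) (value_form t k (Suc k)) \<longleftrightarrow> a = num (aeval \<nu> t)"
    if "a \<in> G" for a
    by (subst sat_value[where \<nu> = \<nu>]) (use AEq.prems(1) upd k4 that in \<open>auto simp: k_def\<close>)
  show ?case
    using s t num(1) inj_eq[OF num(2)] by (auto simp: Let_def k_def[symmetric])
next
  case (AEx n \<phi>)
  have "sat (v(n + 3 := num a)) (translate \<phi>) \<longleftrightarrow> asat (\<nu>(n := a)) \<phi>" for a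
  proof (rule AEx.IH)
    show "param_val (v(n + 3 := num a))"
      by (rule param_val_upd[THEN iffD2]) (use AEx.prems(1) in auto)
  qed (use AEx.prems(2) in auto)
  moreover have "sat (v(n + 3 := x)) (nat_form (n + 3)) \<longleftrightarrow> x \<in> range num" if "x \<in> G" for x
    by (subst sat_nat) (use AEx.prems that in auto)
  ultimately have "sat v (translate (AEx n \<phi>)) \<longleftrightarrow>
      (\<exists>x\<in>G. x \<in> range num \<and> sat (v(n + 3 := x)) (translate \<phi>))"
    "asat \<nu> (AEx n \<phi>) \<longleftrightarrow> (\<exists>a. sat (v(n + 3 := num a)) (translate \<phi>))"
    by auto
  then show ?case using num(1) by blast
qed auto

lemma sat_nats:
  "param_val v \<Longrightarrow> (\<And>j. j < k \<Longrightarrow> v (j + 3) \<in> G) \<Longrightarrow>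
   sat v (nats_form k) \<longleftrightarrow> (\<forall>j<k. v (j + 3) \<in> range num)"
  by (induction k) (auto simp: sat_nat less_Suc_eq)

lemma definable_arith_image:
  assumes "arith_definable k X"
  shows "gdefinable_params G m i e k (map num ` X)"
proof -
  obtain \<phi> where \<phi>: "afv \<phi> \<subseteq> {..<k}"
    "X = {ns. length ns = k \<and> asat (\<lambda>n. if n < k then ns ! n else 0) \<phi>}"
    using assms unfolding arith_definable_def by blast
  \<comment> \<open>The translation keeps parameters in variables 0, 1, 2 and the tuple from 3 on,
    while \<open>gdefinable_params\<close> puts the tuple first and the parameters at k, k+1, k+2.
    The map \<open>\<pi>\<close> permutes these k + 3 variables accordingly and fixes the
    others.\<close>
  define \<pi> :: "nat \<Rightarrow> nat" where "\<pi> n = (if n < 3 then k + n else if n < k + 3 then n - 3 else n)" for n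
  have inj: "inj \<pi>" by (rule injI) (auto simp: \<pi>_def split: if_splits)
  \<comment> \<open>The conjunct \<open>nats_form k\<close> restricts the tuple to codes, the only
    assignments on which \<open>sat_translate\<close> evaluates the translation.\<close>
  define \<psi> where "\<psi> = GAnd (nats_form k) (translate \<phi>)"
  have "gfv \<psi> \<subseteq> {0,1,2} \<union> (\<lambda>j. j + 3) ` {..<k}"
    using gfv_nats_form[of k] gfv_translate[of \<phi>] \<phi>(1) unfolding \<psi>_def by auto
  then have fv: "gfv (frename \<pi> \<psi>) \<subseteq> {..<k + 3}"
    unfolding gfv_frename[OF inj] by (auto simp: \<pi>_def)
  define val where "val xs = (\<lambda>n. if n < k then xs ! n else if n < k + length [c0,c1,c2] then [c0,c1,c2] ! (n - k) else e)" for xs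
  have val: "param_val (val xs \<circ> \<pi>)" "\<And>j. j < k \<Longrightarrow> (val xs \<circ> \<pi>) (j + 3) = xs ! j" for xs
    by (auto simp: param_val_def val_def \<pi>_def numeral_2_eq_2)
  have "map num ` X = {xs. length xs = k \<and> set xs \<subseteq> G \<and> sat (val xs) (frename \<pi> \<psi>)}"
  proof (intro equalityI subsetI)
    fix xs assume "xs \<in> map num ` X"
    then obtain ns where ns: "xs = map num ns" "length ns = k" "asat (\<lambda>n. if n < k then ns ! n else 0) \<phi>"
      using \<phi>(2) by auto
    have "sat (val xs \<circ> \<pi>) (translate \<phi>)"
      by (subst sat_translate[OF val(1), where \<nu> = "\<lambda>n. if n < k then ns ! n else 0"])
         (use ns \<phi>(1) val(2)[of _ xs] in auto)
    moreover have "sat (val xs \<circ> \<pi>) (nats_form k)"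
      by (subst sat_nats[OF val(1)]) (use ns num(1) val(2)[of _ xs] in auto)
    ultimately show "xs \<in> {xs. length xs = k \<and> set xs \<subseteq> G \<and> sat (val xs) (frename \<pi> \<psi>)}"
      using ns num(1) by (auto simp: gsat_frename[OF inj] \<psi>_def)
  next
    fix xs assume "xs \<in> {xs. length xs = k \<and> set xs \<subseteq> G \<and> sat (val xs) (frename \<pi> \<psi>)}"
    then have xs: "length xs = k" "set xs \<subseteq> G" "sat (val xs \<circ> \<pi>) (nats_form k)" "sat (val xs \<circ> \<pi>) (translate \<phi>)"
      by (auto simp: gsat_frename[OF inj] \<psi>_def)
    have "\<forall>j<k. xs ! j \<in> range num"
      using xs(3) by (subst (asm) sat_nats[OF val(1)]) (use xs(1,2) val(2)[of _ xs] in auto)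
    then have "set xs \<subseteq> range num" using xs(1) by (auto simp: in_set_conv_nth)
    then obtain ns where ns: "xs = map num ns"
      by (metis ex_map_conv image_subset_iff rangeE subset_eq)
    have "asat (\<lambda>n. if n < k then ns ! n else 0) \<phi>"
      using xs(4)
      by (subst (asm) sat_translate[OF val(1), where \<nu> = "\<lambda>n. if n < k then ns ! n else 0"])
         (use ns xs(1) \<phi>(1) val(2)[of _ xs] in auto)
    then show "xs \<in> map num ` X" using ns xs(1) \<phi>(2) by auto
  qed
  then show ?thesis
    unfolding gdefinable_params_def
    by (intro exI[of _ "frename \<pi> \<psi>"] exI[of _ "[c0,c1,c2]"])
       (use params fv in \<open>auto simp: val_def\<close>)
qed

lemma interprets_arith: "interprets_arith_params G m i e"
proof -
  \<comment> \<open>The interpretation is one-dimensional and every number has exactly one code, so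
    preimages of sets of tuples are images under \<open>map num\<close>.\<close>
  define D where "D = (\<lambda>n. [num n]) ` UNIV"
  define f where "f xs = inv num (hd xs)" for xs
  have f: "f [num n] = n" for n using num(2) by (simp add: f_def)
  have eq: "{concat ds | ds. length ds = k \<and> set ds \<subseteq> D \<and> map f ds \<in> X} = map num ` X"
    if X: "arith_definable k X" for k X
  proof (intro equalityI subsetI)
    fix xs assume "xs \<in> {concat ds | ds. length ds = k \<and> set ds \<subseteq> D \<and> map f ds \<in> X}"
    then obtain ds where ds: "xs = concat ds" "set ds \<subseteq> D" "map f ds \<in> X" by blast
    from ds(2) have "concat ds = map num (map f ds)"
      by (induction ds) (auto simp: D_def f)
    with ds show "xs \<in> map num ` X" by (metis imageI)
  next
    fix xs assume "xs \<in> map num ` X"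
    then obtain ns where ns: "xs = map num ns" "ns \<in> X" by blast
    have "length ns = k" using ns X unfolding arith_definable_def by auto
    moreover have "concat (map (\<lambda>n. [num n]) ns) = map num ns" by (induction ns) auto
    ultimately show "xs \<in> {concat ds | ds. length ds = k \<and> set ds \<subseteq> D \<and> map f ds \<in> X}"
      using ns by (auto intro!: exI[of _ "map (\<lambda>n. [num n]) ns"] simp: D_def o_def f)
  qed
  show ?thesis
    unfolding interprets_arith_params_def
    by (intro exI[of _ 1] exI[of _ D] exI[of _ f])
       (auto simp: eq definable_arith_image f num(1) image_image, auto simp: D_def f num(1) image_image)
qed

end

subsection \<open>Bump functions and right slopes\<close>

definition fpow :: "('a \<Rightarrow> 'a) \<Rightarrow> int \<Rightarrow> 'a \<Rightarrow> 'a" where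
  "fpow X j = (if 0 \<le> j then X ^^ nat j else inv X ^^ nat (- j))"

lemma fpow_0 [simp]: "fpow X 0 = id"
  by (simp add: fpow_def)

lemma fpow_1 [simp]: "fpow X 1 = X"
  by (simp add: fpow_def)

lemma fpow_of_nat: "fpow X (int n) = X ^^ n"
  by (simp add: fpow_def)

lemma comp_left_cancel: "bij X \<Longrightarrow> X \<circ> f = X \<circ> g \<longleftrightarrow> f = g"
  by (auto simp: fun_eq_iff bij_def inj_eq)

lemma fpow_Suc:
  assumes "bij X" shows "fpow X (j + 1) = X \<circ> fpow X j"
proof (cases "0 \<le> j")
  case True
  then show ?thesis by (simp add: fpow_def nat_add_distrib)
next
  case False
  then obtain n where n: "j = - int (Suc n)"
    using negD[of j] by auto
  have "X \<circ> (inv X \<circ> g) = g" for g :: "'a \<Rightarrow> 'a"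
    using assms by (simp add: fun_eq_iff bij_is_surj surj_f_inv_f)
  from this[of id] this show ?thesis by (cases n) (simp_all add: fpow_def n nat_add_distrib)
qed

lemma fpow_add:
  assumes "bij X" shows "fpow X (j + k) = fpow X j \<circ> fpow X k"
proof (induction j rule: int_induct[where k = 0])
  case (step1 j)
  then show ?case using fpow_Suc[OF assms, of "j + k"] fpow_Suc[OF assms, of j]
    by (simp add: algebra_simps comp_assoc)
next
  case (step2 j)
  have "X \<circ> fpow X (j - 1 + k) = fpow X (j + k)"
    using fpow_Suc[OF assms, of "j - 1 + k"] by (simp add: algebra_simps)
  also have "\<dots> = X \<circ> (fpow X (j - 1) \<circ> fpow X k)"
    using step2 fpow_Suc[OF assms, of "j - 1"] by (simp add: fun_eq_iff)
  finally have "X \<circ> fpow X (j - 1 + k) = X \<circ> (fpow X (j - 1) \<circ> fpow X k)" .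
  then show ?case using comp_left_cancel[OF assms] by blast
qed simp

lemma fpow_commute: "bij X \<Longrightarrow> fpow X j \<circ> fpow X k = fpow X k \<circ> fpow X j"
  by (metis fpow_add add.commute)

lemma fpow_neg: "bij X \<Longrightarrow> fpow X (- j) \<circ> fpow X j = id"
  by (metis fpow_add fpow_0 add.left_inverse)

lemma bij_fpow: "bij X \<Longrightarrow> bij (fpow X j)"
  by (metis fpow_neg o_bij add.inverse_inverse)

lemma inv_fpow: "bij X \<Longrightarrow> inv (fpow X j) = fpow X (- j)"
  by (metis fpow_neg inv_unique_comp add.inverse_inverse)

lemma fpow_commutes:
  assumes "bij X" "x \<circ> X = X \<circ> x" shows "x \<circ> fpow X j = fpow X j \<circ> x"
proof -
  have x: "x (X t) = X (x t)" for t using assms(2) by (metis o_apply)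
  have "x (fpow X j t) = fpow X j (x t)" for t
  proof (induction j rule: int_induct[where k = 0])
    case (step1 j)
    then show ?case by (simp add: fpow_Suc[OF assms(1)] x)
  next
    case (step2 j)
    have "fpow X j u = X (fpow X (j - 1) u)" for u
      using fpow_Suc[OF assms(1), of "j - 1"] by (simp add: fun_eq_iff)
    then have "X (x (fpow X (j - 1) t)) = X (fpow X (j - 1) (x t))" using step2 x by metis
    then show ?case using assms(1) by (simp add: bij_def inj_eq)
  qed simp
  then show ?thesis by (simp add: fun_eq_iff)
qed

text \<open>An increasing surjection of the line is continuous, so these are homeomorphisms that
  push every point of (c,d) to the right and fix all others.\<close>

locale bump =
  fixes X :: "real \<Rightarrow> real" and c d :: real
  assumes mono: "strict_mono X" and surj: "surj X" and less: "c < d"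
    and fix_outside: "t \<notin> {c<..<d} \<Longrightarrow> X t = t"
    and up: "t \<in> {c<..<d} \<Longrightarrow> t < X t"
begin

lemma bij: "bij X"
  using mono surj by (simp add: bij_def strict_mono_imp_inj_on)

lemma moved_iff: "X t \<noteq> t \<longleftrightarrow> t \<in> {c<..<d}"
  using fix_outside up by fastforce

lemma mem_iff: "X t \<in> {c<..<d} \<longleftrightarrow> t \<in> {c<..<d}"
  by (metis bij bij_is_inj injD moved_iff)

lemma fpow_mono: "s < t \<Longrightarrow> fpow X j s < fpow X j t"
proof (induction j rule: int_induct[where k = 0])
  case (step1 j)
  then show ?case using mono by (simp add: fpow_Suc[OF bij] strict_mono_less)
next
  case (step2 j)
  then have "X (fpow X (j - 1) s) < X (fpow X (j - 1) t)"
    using fpow_Suc[OF bij, of "j - 1"] by (simp add: fun_eq_iff)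
  then show ?case using mono by (simp add: strict_mono_less)
qed simp

lemma fpow_less_iff: "fpow X j s < fpow X j t \<longleftrightarrow> s < t"
  by (metis fpow_mono less_asym linorder_neqE)

lemma fpow_le: "s \<le> t \<Longrightarrow> fpow X j s \<le> fpow X j t"
  using fpow_less_iff not_less by metis

lemma fpow_mem_iff: "fpow X j t \<in> {c<..<d} \<longleftrightarrow> t \<in> {c<..<d}"
proof (induction j rule: int_induct[where k = 0])
  case (step1 j)
  then show ?case by (simp only: fpow_Suc[OF bij] o_apply mem_iff)
next
  case (step2 j)
  have "fpow X j t = X (fpow X (j - 1) t)"
    using fpow_Suc[OF bij, of "j - 1"] by (simp add: fun_eq_iff)
  then show ?case using mem_iff step2 by metis
qed simp

lemma fpow_fix_outside:
  assumes t: "t \<notin> {c<..<d}" shows "fpow X j t = t"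
proof (induction j rule: int_induct[where k = 0])
  case (step1 j)
  then show ?case using fix_outside[OF t] by (simp add: fpow_Suc[OF bij])
next
  case (step2 j)
  have "X (fpow X (j - 1) t) = X t"
    using fpow_Suc[OF bij, of "j - 1"] step2 fix_outside[OF t] by (simp add: fun_eq_iff)
  then show ?case using bij by (simp add: bij_def inj_eq)
qed simp

lemma fpow_mono_exponent:
  assumes "t \<in> {c<..<d}" "j < k" shows "fpow X j t < fpow X k t"
proof -
  have *: "fpow X j t < fpow X (j + 1 + int n) t" for n
  proof (induction n)
    case 0
    then show ?case using up[of "fpow X j t"] fpow_mem_iff assms by (simp add: fpow_Suc[OF bij])
  next
    case (Suc n)
    have "fpow X (j + 1 + int n) t < fpow X (j + 1 + int n + 1) t"
      using up[of "fpow X (j + 1 + int n) t"] fpow_mem_iff assms by (simp only: fpow_Suc[OF bij]) simp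
    with Suc show ?case by (simp add: algebra_simps)
  qed
  from assms show ?thesis using *[of "nat (k - j - 1)"] by simp
qed

text \<open>If the orbit of s stayed below t, its supremum S would lie in (c,d). The preimage of S
  is smaller than S, so some orbit point exceeds it, and the next orbit point exceeds S.\<close>

lemma unbounded_orbit:
  assumes s: "s \<in> {c<..<d}" and t: "t \<in> {c<..<d}"
  obtains j where "t < fpow X j s"
proof (rule ccontr)
  assume "\<not> thesis"
  with that have bound: "fpow X j s \<le> t" for j using not_less by blast
  define S where "S = (SUP j. fpow X j s)"
  have bdd: "bdd_above (range (\<lambda>j. fpow X j s))" by (rule bdd_aboveI2[where M = t]) (rule bound)
  have le: "fpow X j s \<le> S" for j unfolding S_def by (rule cSUP_upper[OF UNIV_I bdd])
  have "S \<le> t" unfolding S_def by (rule cSUP_least) (use bound in auto)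
  moreover have "s \<le> S" using le[of 0] by simp
  ultimately have S: "S \<in> {c<..<d}" using s t by auto
  obtain S' where S': "X S' = S" using surj by (metis surjD)
  then have "S' \<in> {c<..<d}" using mem_iff S by metis
  then have "S' < S" using up S' by fastforce
  then obtain j where "S' < fpow X j s"
    unfolding S_def using less_cSUP_iff[OF _ bdd] by auto
  then have "S < fpow X (j + 1) s"
    using S' mono by (metis fpow_Suc[OF bij] o_apply strict_mono_less)
  then show False using le[of "j + 1"] by simp
qed

lemma unbounded_orbit_below:
  assumes s: "s \<in> {c<..<d}" and t: "t \<in> {c<..<d}"
  obtains j where "fpow X j s < t"
proof -
  obtain j where "s < fpow X j t" using unbounded_orbit[OF t s] .
  then have "fpow X (- j) s < fpow X (- j) (fpow X j t)" by (rule fpow_mono)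
  also have "\<dots> = t" using fpow_neg[OF bij] by (metis o_apply id_apply)
  finally show ?thesis using that by blast
qed

lemma orbit_between:
  assumes s: "s \<in> {c<..<d}" and t: "t \<in> {c<..<d}"
  obtains j where "fpow X j s \<le> t" "t < fpow X (j + 1) s"
proof -
  obtain j0 where j0: "fpow X j0 s < t" using unbounded_orbit_below[OF s t] .
  obtain j1 where j1: "t < fpow X j1 s" using unbounded_orbit[OF s t] .
  have "j0 < j1"
    using j0 j1 fpow_mono_exponent[OF s, of j1 j0] by (metis less_asym less_trans linorder_neqE)
  define n where "n = (LEAST n. t < fpow X (j0 + int n) s)"
  have ex: "t < fpow X (j0 + int (nat (j1 - j0))) s" using j1 \<open>j0 < j1\<close> by simp
  have n: "t < fpow X (j0 + int n) s" unfolding n_def by (rule LeastI) (rule ex)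
  have "n \<noteq> 0" using n j0 by (intro notI) simp
  then obtain n' where n': "n = Suc n'" using not0_implies_Suc by blast
  have "\<not> t < fpow X (j0 + int n') s"
    using not_less_Least[of n' "\<lambda>n. t < fpow X (j0 + int n) s"] n' unfolding n_def by simp
  then show ?thesis using that[of "j0 + int n'"] n n' by (simp add: algebra_simps)
qed

text \<open>The interval (c,d) is exactly the set of points moved by \<open>X\<close>, and any
  bijection commuting with \<open>X\<close> preserves that set, even a discontinuous one.\<close>

lemma commuting_mem_iff:
  assumes "bij x" "x \<circ> X = X \<circ> x"
  shows "x t \<in> {c<..<d} \<longleftrightarrow> t \<in> {c<..<d}"
proof -
  have "X (x t) = x (X t)" using assms(2) by (metis o_apply)
  then have "X (x t) \<noteq> x t \<longleftrightarrow> X t \<noteq> t" using assms(1) by (simp add: bij_def inj_eq)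
  then show ?thesis by (simp only: moved_iff)
qed

end

section \<open>One-sided affine germs and commuting with a bump\<close>

definition right_affine :: "(real \<Rightarrow> real) \<Rightarrow> real \<Rightarrow> real \<Rightarrow> bool" where
  "right_affine x c l \<longleftrightarrow> 0 < l \<and> (\<exists>\<epsilon>>0. \<forall>t. c \<le> t \<and> t < c + \<epsilon> \<longrightarrow> x t = x c + l * (t - c))"

lemma right_affine_unique:
  assumes "right_affine x c l" "right_affine x c l'" shows "l = l'"
proof -
  obtain \<epsilon> \<epsilon>' where e: "\<epsilon> > 0" "\<epsilon>' > 0" "\<And>t. c \<le> t \<and> t < c + \<epsilon> \<Longrightarrow> x t = x c + l * (t - c)"
    "\<And>t. c \<le> t \<and> t < c + \<epsilon>' \<Longrightarrow> x t = x c + l' * (t - c)"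
    using assms unfolding right_affine_def by blast
  define t where "t = c + min \<epsilon> \<epsilon>' / 2"
  have "c < t" "t < c + \<epsilon>" "t < c + \<epsilon>'" using e(1,2) by (auto simp: t_def)
  with e(3)[of t] e(4)[of t] have "l * (t - c) = l' * (t - c)" by simp
  with \<open>c < t\<close> show ?thesis by simp
qed

lemma right_affine_comp:
  assumes "right_affine x c l" "right_affine y (x c) l'" shows "right_affine (y \<circ> x) c (l' * l)"
proof -
  obtain \<epsilon> \<epsilon>' where e: "\<epsilon> > 0" "\<epsilon>' > 0" "\<And>t. c \<le> t \<and> t < c + \<epsilon> \<Longrightarrow> x t = x c + l * (t - c)"
    "\<And>t. x c \<le> t \<and> t < x c + \<epsilon>' \<Longrightarrow> y t = y (x c) + l' * (t - x c)" and l: "l > 0" "l' > 0"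
    using assms unfolding right_affine_def by blast
  have "(y \<circ> x) t = (y \<circ> x) c + l' * l * (t - c)" if "c \<le> t" "t < c + min \<epsilon> (\<epsilon>' / l)" for t
  proof -
    have x: "x t = x c + l * (t - c)" using e(3)[of t] that by simp
    have "t - c < \<epsilon>' / l" using that by auto
    then have "l * (t - c) < \<epsilon>'" using l by (simp add: field_simps)
    then have "y (x t) = y (x c) + l' * (x t - x c)" using e(4)[of "x t"] x l that by simp
    then show ?thesis using x by simp
  qed
  moreover have "min \<epsilon> (\<epsilon>' / l) > 0" using e(1,2) l by simp
  moreover have "0 < l' * l" using l by simp
  ultimately show ?thesis unfolding right_affine_def by blast
qed

text \<open>Here \<open>x\<close> may be discontinuous and need not preserve order. If x c < c,
  points just right of c would leave (c,d), which \<open>x\<close> preserves. If x c > c, backward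
  orbit points X^j t0 tend to c and have images above x c, but these images are X^j (x t0) and also
  tend to c.\<close>

lemma (in bump) commuting_fix_left:
  assumes x: "bij x" "x \<circ> X = X \<circ> x" and aff: "right_affine x c l"
  shows "x c = c"
proof (rule ccontr)
  assume ne: "x c \<noteq> c"
  obtain \<epsilon> where e: "\<epsilon> > 0" "\<And>t. c \<le> t \<Longrightarrow> t < c + \<epsilon> \<Longrightarrow> x t = x c + l * (t - c)" and l: "l > 0"
    using aff unfolding right_affine_def by blast
  have gt: "x c > c"
  proof (rule ccontr)
    assume "\<not> x c > c"
    with ne have "x c < c" by simp
    \<comment> \<open>The third entry of the minimum ensures x c + l h \<le> c; the others keep c +
      h in the affine range and inside (c,d).\<close>
    define h where "h = Min {\<epsilon> / 2, (d - c) / 2, (c - x c) / l}"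
    have h: "h > 0" "h < \<epsilon>" "h < d - c" "h \<le> (c - x c) / l"
      using e(1) l less \<open>x c < c\<close> by (auto simp: h_def min_less_iff_disj)
    have "x (c + h) = x c + l * h" using e(2)[of "c + h"] h by simp
    moreover have "l * h \<le> c - x c" using h l by (simp add: field_simps)
    moreover have "x (c + h) \<in> {c<..<d}" using commuting_mem_iff[OF x] h by auto
    ultimately show False by simp
  qed
  define t0 where "t0 = c + min (\<epsilon> / 2) ((d - c) / 2)"
  have t0: "t0 \<in> {c<..<d}" "t0 < c + \<epsilon>" using e(1) less by (auto simp: t0_def min_def field_simps)
  \<comment> \<open>The threshold s is at most x c and t0 and still lies in (c,d). Applying the
    orbit lemma to the larger of t0 and x t0 brings both orbits below s with the same
    exponent.\<close>
  define s where "s = min t0 (min (x c) ((c + d) / 2))"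
  have s: "s \<in> {c<..<d}" "s \<le> x c" "s \<le> t0" using t0 gt less by (auto simp: s_def)
  have xt0: "x t0 \<in> {c<..<d}" using commuting_mem_iff[OF x] t0 by blast
  have "max t0 (x t0) \<in> {c<..<d}" using t0(1) xt0 by (simp add: max_def)
  from unbounded_orbit_below[OF this s(1)] obtain j where j: "fpow X j (max t0 (x t0)) < s" .
  have t0j: "fpow X j t0 < s" "fpow X j (x t0) < s"
    using j fpow_le[of t0 "max t0 (x t0)" j] fpow_le[of "x t0" "max t0 (x t0)" j] by linarith+
  have "fpow X j t0 \<in> {c<..<d}" using t0 fpow_mem_iff by blast
  then have "x (fpow X j t0) > x c" using e(2)[of "fpow X j t0"] t0j s t0 l by auto
  moreover have "x (fpow X j t0) = fpow X j (x t0)"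
    using fpow_commutes[OF bij x(2)] by (metis o_apply)
  ultimately show False using t0j s by simp
qed

subsection \<open>Standard bumps and their kinks\<close>

text \<open>The slopes are \<open>\<kappa>\<close>, 1 and 1/\<open>\<kappa>\<close>, changing at c +
  u and d - \<open>\<kappa>\<close> u. Writing the map as a minimum of three increasing affine
  functions makes monotonicity and concavity easy to see. The assumption \<open>room\<close> below
  puts the two kinks in the right order.\<close>

definition std_bump :: "real \<Rightarrow> real \<Rightarrow> real \<Rightarrow> real \<Rightarrow> real \<Rightarrow> real" where
  "std_bump \<kappa> c d u t = (if c \<le> t \<and> t \<le> d
     then min (c + \<kappa> * (t - c)) (min (t + (\<kappa> - 1) * u) (d - (d - t) / \<kappa>)) else t)"

locale standard_bump =
  fixes \<kappa> c d u :: real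
  assumes slope: "1 < \<kappa>" and u: "0 < u" and room: "(1 + \<kappa>) * u < d - c"
begin

abbreviation X :: "real \<Rightarrow> real" where "X \<equiv> std_bump \<kappa> c d u"
abbreviation q1 :: real where "q1 \<equiv> c + u"
abbreviation q2 :: real where "q2 \<equiv> d - \<kappa> * u"

lemma cuts: "c < q1" "q1 < q2" "q2 < d" "c < d"
proof -
  show "c < q1" using u by simp
  show 1: "q1 < q2" using room by (simp add: algebra_simps)
  show 2: "q2 < d" using slope u by simp
  show "c < d" using 1 2 u by linarith
qed

lemma pieces:
  "c \<le> t \<Longrightarrow> t \<le> q1 \<Longrightarrow> X t = c + \<kappa> * (t - c)"
  "q1 \<le> t \<Longrightarrow> t \<le> q2 \<Longrightarrow> X t = t + (\<kappa> - 1) * u"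
  "q2 \<le> t \<Longrightarrow> t \<le> d \<Longrightarrow> X t = d - (d - t) / \<kappa>"
  "t \<notin> {c<..<d} \<Longrightarrow> X t = t"
proof -
  have first: "c + \<kappa> * (t - c) \<le> t + (\<kappa> - 1) * u \<longleftrightarrow> t \<le> q1" for t
  proof -
    have "t + (\<kappa> - 1) * u - (c + \<kappa> * (t - c)) = (\<kappa> - 1) * (q1 - t)" by (simp add: algebra_simps)
    moreover have "0 \<le> (\<kappa> - 1) * (q1 - t) \<longleftrightarrow> t \<le> q1" using slope by (simp add: zero_le_mult_iff)
    ultimately show ?thesis by linarith
  qed
  have second: "t + (\<kappa> - 1) * u \<le> d - (d - t) / \<kappa> \<longleftrightarrow> t \<le> q2"
    "d - (d - t) / \<kappa> \<le> t + (\<kappa> - 1) * u \<longleftrightarrow> q2 \<le> t" for t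
  proof -
    have "d - (d - t) / \<kappa> - (t + (\<kappa> - 1) * u) = (\<kappa> - 1) / \<kappa> * (q2 - t)"
      using slope by (simp add: field_simps)
    moreover have "0 \<le> (\<kappa> - 1) / \<kappa> * (q2 - t) \<longleftrightarrow> t \<le> q2" "(\<kappa> - 1) / \<kappa> * (q2 - t) \<le> 0 \<longleftrightarrow> q2 \<le> t"
      using slope by (simp_all add: zero_le_mult_iff zero_le_divide_iff mult_le_0_iff divide_le_0_iff)
    ultimately show "t + (\<kappa> - 1) * u \<le> d - (d - t) / \<kappa> \<longleftrightarrow> t \<le> q2"
      "d - (d - t) / \<kappa> \<le> t + (\<kappa> - 1) * u \<longleftrightarrow> q2 \<le> t" by linarith+
  qed
  note i = first[of t] second[of t] and c = cuts
  show "c \<le> t \<Longrightarrow> t \<le> q1 \<Longrightarrow> X t = c + \<kappa> * (t - c)" using i c by (simp add: std_bump_def min_def)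
  show "q1 \<le> t \<Longrightarrow> t \<le> q2 \<Longrightarrow> X t = t + (\<kappa> - 1) * u"
    using i c by (cases "t = q1") (simp_all add: std_bump_def min_def algebra_simps)
  show "X t = d - (d - t) / \<kappa>" if t: "q2 \<le> t" "t \<le> d"
  proof -
    have "d - (d - t) / \<kappa> \<le> t + (\<kappa> - 1) * u" using second t by blast
    moreover have "t + (\<kappa> - 1) * u \<le> c + \<kappa> * (t - c)" using first[of t] t c by linarith
    ultimately have "min (c + \<kappa> * (t - c)) (min (t + (\<kappa> - 1) * u) (d - (d - t) / \<kappa>)) = d - (d - t) / \<kappa>"
      by (simp add: min_absorb2)
    then show ?thesis using t c by (simp add: std_bump_def)
  qed
  have "X c = c" using first[of c] second[of c] c by (simp add: std_bump_def min_def)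
  moreover have "X d = d" using first[of d] second[of d] c by (simp add: std_bump_def min_def)
  moreover assume "t \<notin> {c<..<d}"
  ultimately show "X t = t" by (auto simp: std_bump_def)
qed

lemma upper: 
  assumes "c \<le> t" "t \<le> d"
  shows "X t \<le> c + \<kappa> * (t - c)" "X t \<le> t + (\<kappa> - 1) * u" "X t \<le> d - (d - t) / \<kappa>"
  using assms by (simp_all add: std_bump_def)

lemma strict_mono_X: "strict_mono X"
proof (rule strict_monoI)
  fix s t :: real assume st: "s < t"
  have ends: "X c = c" "X d = d" using pieces(4) by auto
  have inner: "X s < X t" if "c \<le> s" "s < t" "t \<le> d" for s t
  proof -
    have "c + \<kappa> * (s - c) < c + \<kappa> * (t - c)" using slope that by simp
    moreover have "d - (d - s) / \<kappa> < d - (d - t) / \<kappa>"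
      using slope that by (simp add: divide_strict_right_mono)
    ultimately show ?thesis using that by (simp add: std_bump_def min_less_iff_disj)
  qed
  have out: "X t = t" if "t \<le> c \<or> d \<le> t" for t using pieces(4)[of t] that by auto
  have ge: "c \<le> X t" if "c \<le> t" "t \<le> d" for t
    using inner[of c t] ends that by (cases "t = c") auto
  have le: "X t \<le> d" if "c \<le> t" "t \<le> d" for t
    using inner[of t d] ends that by (cases "t = d") auto
  consider "s < c" | "c \<le> s" "t \<le> d" | "c \<le> s" "d < t" by linarith
  then show "X s < X t"
  proof cases
    case 1
    then show ?thesis using out[of s] out[of t] ge[of t] st by (cases "t \<le> c"; cases "d \<le> t") auto
  next
    case 3
    then show ?thesis using out[of s] out[of t] le[of s] st by (cases "d \<le> s") auto
  qed (use inner st in auto)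
qed

text \<open>The inverse of a minimum of increasing bijections is the maximum of their inverses; the
  three entries invert the three affine pieces.\<close>

lemma preimage:
  assumes y: "c \<le> y" "y \<le> d"
  defines "w \<equiv> max (c + (y - c) / \<kappa>) (max (y - (\<kappa> - 1) * u) (d - \<kappa> * (d - y)))"
  shows "X w = y"
proof -
  define a1 a2 a3 where a: "a1 = c + (y - c) / \<kappa>" "a2 = y - (\<kappa> - 1) * u" "a3 = d - \<kappa> * (d - y)"
  have w: "w = max a1 (max a2 a3)" by (simp add: w_def a)
  have pos: "0 < (\<kappa> - 1) * u" using slope u by simp
  have "c \<le> a1" using y slope by (simp add: a)
  then have "c \<le> w" by (simp add: w)
  have "y - c \<le> \<kappa> * (y - c)" "d - y \<le> \<kappa> * (d - y)" using y slope
    by (simp_all add: mult_le_cancel_right1)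
  then have "a1 \<le> y" "a3 \<le> y" using slope by (simp_all add: a field_simps)
  moreover have "a2 \<le> y" using pos by (simp add: a)
  ultimately have "w \<le> d" using y by (simp add: w)
  have inv: "c + \<kappa> * (a1 - c) = y" "a2 + (\<kappa> - 1) * u = y" "d - (d - a3) / \<kappa> = y"
    using slope by (simp_all add: a)
  have m: "c + \<kappa> * (s - c) \<le> c + \<kappa> * (t - c)" "d - (d - s) / \<kappa> \<le> d - (d - t) / \<kappa>" if "s \<le> t" for s t
    using slope that by (simp_all add: divide_right_mono)
  have ge: "y \<le> c + \<kappa> * (w - c)" "y \<le> w + (\<kappa> - 1) * u" "y \<le> d - (d - w) / \<kappa>"
    using m(1)[of a1 w] m(2)[of a3 w] inv by (simp_all add: w)
  have min3: "min p (min q s) = y" if "y \<le> p" "y \<le> q" "y \<le> s" "p = y \<or> q = y \<or> s = y" for p q s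
    using that by (auto simp: min_def)
  have "w = a1 \<or> w = a2 \<or> w = a3" by (auto simp: w max_def)
  then have "min (c + \<kappa> * (w - c)) (min (w + (\<kappa> - 1) * u) (d - (d - w) / \<kappa>)) = y"
    by (intro min3 ge) (use inv in blast)
  then show ?thesis using \<open>c \<le> w\<close> \<open>w \<le> d\<close> by (simp add: std_bump_def)
qed

sublocale bump X c d
proof
  show "surj X"
    by (rule surjI[of _ "\<lambda>y. if c \<le> y \<and> y \<le> d then max (c + (y - c) / \<kappa>) (max (y - (\<kappa> - 1) * u) (d - \<kappa> * (d - y))) else y"])
       (use preimage in \<open>auto simp: pieces(4)\<close>)
  fix t assume t: "t \<in> {c<..<d}"
  have "t - c < \<kappa> * (t - c)" "0 < (\<kappa> - 1) * u" "d - t < \<kappa> * (d - t)" using slope u t by auto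
  moreover from this have "(d - t) / \<kappa> < d - t" using slope by (simp add: field_simps)
  ultimately have "t < c + \<kappa> * (t - c)" "t < t + (\<kappa> - 1) * u" "t < d - (d - t) / \<kappa>" by linarith+
  then show "t < X t" using t by (simp add: std_bump_def)
qed (use strict_mono_X cuts pieces(4) in auto)

text \<open>At the midpoint of a and b one of the three affine functions attains the minimum, and it
  bounds \<open>X\<close> from above at a and b. Allowing m to lie beyond the midpoint builds in
  monotonicity, so the inequality can be fed back into itself under iteration.\<close>

lemma concave:
  assumes "a \<in> {c<..<d}" "b \<in> {c<..<d}" "a + b \<le> 2 * m" "m \<in> {c<..<d}"
  shows "X a + X b \<le> 2 * X m"
proof -
  define h where "h = (a + b) / 2"
  have h: "c \<le> h" "h \<le> d" "h \<le> m" "a + b = 2 * h" using assms by (auto simp: h_def)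
  have ab: "c \<le> a" "a \<le> d" "c \<le> b" "b \<le> d" using assms by auto
  have e1: "(c + \<kappa> * (a - c)) + (c + \<kappa> * (b - c)) = 2 * (c + \<kappa> * (h - c))"
  proof -
    have "(c + \<kappa> * (a - c)) + (c + \<kappa> * (b - c)) = 2 * c + \<kappa> * ((a + b) - 2 * c)" by (simp add: algebra_simps)
    then show ?thesis unfolding h(4) by (simp add: algebra_simps)
  qed
  have e3: "(d - (d - a) / \<kappa>) + (d - (d - b) / \<kappa>) = 2 * (d - (d - h) / \<kappa>)"
  proof -
    have "(d - (d - a) / \<kappa>) + (d - (d - b) / \<kappa>) = 2 * d - (2 * d - (a + b)) / \<kappa>"
      by (simp add: diff_divide_distrib add_divide_distrib)
    then show ?thesis unfolding h(4) by (simp add: diff_divide_distrib)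
  qed
  have "X h = c + \<kappa> * (h - c) \<or> X h = h + (\<kappa> - 1) * u \<or> X h = d - (d - h) / \<kappa>"
    using h by (auto simp: std_bump_def min_def)
  then have "X a + X b \<le> 2 * X h"
    using upper[OF ab(1,2)] upper[OF ab(3,4)] e1 e3 h(4) by (elim disjE) simp_all
  moreover have "X h \<le> X m" using h(3) mono by (simp add: strict_mono_less_eq)
  ultimately show ?thesis by linarith
qed

lemma concave_strict:
  assumes "a \<in> {c<..<d}" "b \<in> {c<..<d}" "a + b < 2 * m" "m \<in> {c<..<d}"
  shows "X a + X b < 2 * X m"
proof -
  have "X a + X b \<le> 2 * X ((a + b) / 2)" by (rule concave) (use assms in auto)
  also have "X ((a + b) / 2) < X m" using assms mono by (simp add: strict_mono_less)
  finally show ?thesis by simp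
qed

text \<open>Strict midpoint concavity survives composition with concave increasing maps, so it detects
  the kinks of iterates of \<open>X\<close> without any risk of cancellation.\<close>

lemma concave_kink:
  assumes "a \<in> {c<..<d}" "b \<in> {c<..<d}" "a + b \<le> 2 * q1" "a < q1"
  shows "X a + X b < 2 * X q1"
proof -
  have "X a \<le> c + \<kappa> * (a - c)" "X b \<le> b + (\<kappa> - 1) * u" using upper assms by auto
  then have "X a + X b - 2 * (c + \<kappa> * u) \<le> (\<kappa> - 1) * (a - q1) + (a + b - 2 * q1)"
    by (simp add: algebra_simps)
  also have "\<dots> < 0" using assms slope by (smt (verit) mult_pos_neg)
  finally show ?thesis using pieces(1)[of q1] u by simp
qed

lemma funpow_mem_iff: "(X ^^ n) t \<in> {c<..<d} \<longleftrightarrow> t \<in> {c<..<d}"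
  using fpow_mem_iff[of "int n" t] by (simp only: fpow_of_nat)

lemma funpow_less_iff: "(X ^^ n) s < (X ^^ n) t \<longleftrightarrow> s < t"
  using fpow_less_iff[of "int n" s t] by (simp only: fpow_of_nat)

text \<open>The weak inequality holds for every iterate. It becomes strict at the step that passes
  through \<open>q1\<close>, and \<open>concave_strict\<close> preserves strictness from then
  on.\<close>

lemma funpow_concave_kink:
  assumes "(X ^^ k) t = q1" "k < n" "0 < h" "t - h \<in> {c<..<d}" "t + h \<in> {c<..<d}"
  shows "(X ^^ n) (t - h) + (X ^^ n) (t + h) < 2 * (X ^^ n) t"
proof -
  have t: "t \<in> {c<..<d}" using assms by auto
  have le: "(X ^^ n) (t - h) + (X ^^ n) (t + h) \<le> 2 * (X ^^ n) t" for n
  proof (induction n)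
    case (Suc n)
    have "(X ^^ n) (t - h) \<in> {c<..<d}" "(X ^^ n) (t + h) \<in> {c<..<d}" "(X ^^ n) t \<in> {c<..<d}"
      using funpow_mem_iff t assms(4,5) by blast+
    from concave[OF this(1,2) Suc this(3)] show ?case by simp
  qed simp
  show ?thesis using \<open>k < n\<close>
  proof (induction n)
    case (Suc n)
    show ?case
    proof (cases "k = n")
      case True
      have "(X ^^ k) (t - h) < q1" using funpow_less_iff[of k "t - h" t] assms by simp
      then show ?thesis
        using concave_kink[of "(X ^^ k) (t - h)" "(X ^^ k) (t + h)"] le[of k] funpow_mem_iff assms True
        by simp
    next
      case False
      then have "k < n" using Suc by simp
      then show ?thesis
        using concave_strict[of "(X ^^ n) (t - h)" "(X ^^ n) (t + h)" "(X ^^ n) t"] Suc.IH funpow_mem_iff t assms(4,5)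
        by simp
    qed
  qed simp
qed

lemma eventually_near:
  fixes s k :: real
  assumes "a < s" "s < b"
  shows "\<forall>\<^sub>F h in nhds 0. a < s + k * h \<and> s + k * h < b"
proof -
  have "((\<lambda>h. s + k * h) \<longlongrightarrow> s) (nhds 0)" by (auto intro!: tendsto_eq_intros filterlim_ident)
  then show ?thesis using assms by (intro eventually_conj order_tendstoD)
qed

lemma locally_affine:
  assumes "s \<in> {c<..<d}" "s \<noteq> q1" "s \<noteq> q2"
  obtains k where "\<forall>\<^sub>F h in nhds 0. X (s + h) = X s + k * h"
proof -
  consider "c < s" "s < q1" | "q1 < s" "s < q2" | "q2 < s" "s < d" using assms by fastforce
  then show thesis
  proof cases
    case 1
    from eventually_near[OF this, of 1] have "\<forall>\<^sub>F h in nhds 0. X (s + h) = X s + \<kappa> * h"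
      by eventually_elim (use 1 in \<open>simp add: pieces(1) algebra_simps\<close>)
    then show ?thesis by (rule that)
  next
    case 2
    from eventually_near[OF this, of 1] have "\<forall>\<^sub>F h in nhds 0. X (s + h) = X s + 1 * h"
      by eventually_elim (use 2 in \<open>simp add: pieces(2)\<close>)
    then show ?thesis by (rule that)
  next
    case 3
    from eventually_near[OF this, of 1] have "\<forall>\<^sub>F h in nhds 0. X (s + h) = X s + (1 / \<kappa>) * h"
      by eventually_elim (use 3 in \<open>simp add: pieces(3) diff_divide_distrib add_divide_distrib\<close>)
    then show ?thesis by (rule that)
  qed
qed

text \<open>By the chain rule an iterate can fail to be affine around s only if an earlier orbit
  point is one of the two kinks. This is the opposite half of the kink detection.\<close>

lemma funpow_locally_affine:
  assumes s: "s \<in> {c<..<d}" and "\<And>j. j < n \<Longrightarrow> (X ^^ j) s \<notin> {q1, q2}"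
  shows "\<exists>k. \<forall>\<^sub>F h in nhds 0. (X ^^ n) (s + h) = (X ^^ n) s + k * h"
  using assms(2)
proof (induction n)
  case 0
  show ?case by (rule exI[of _ 1]) simp
next
  case (Suc n)
  then obtain k where k: "\<forall>\<^sub>F h in nhds 0. (X ^^ n) (s + h) = (X ^^ n) s + k * h" by fastforce
  have "(X ^^ n) s \<in> {c<..<d}" "(X ^^ n) s \<noteq> q1" "(X ^^ n) s \<noteq> q2"
    using Suc.prems[of n] funpow_mem_iff s by auto
  from locally_affine[OF this] obtain l where l: "\<forall>\<^sub>F h in nhds 0. X ((X ^^ n) s + h) = X ((X ^^ n) s) + l * h" .
  have "((\<lambda>h. k * h) \<longlongrightarrow> 0) (nhds 0)" by (auto intro!: tendsto_eq_intros filterlim_ident)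
  with l have "\<forall>\<^sub>F h in nhds 0. X ((X ^^ n) s + k * h) = X ((X ^^ n) s) + l * (k * h)"
    by (rule eventually_compose_filterlim)
  with k have "\<forall>\<^sub>F h in nhds 0. (X ^^ Suc n) (s + h) = (X ^^ Suc n) s + l * k * h"
    by eventually_elim simp
  then show ?case by blast
qed

end

section \<open>Maps commuting with a standard bump\<close>

definition left_affine :: "(real \<Rightarrow> real) \<Rightarrow> real \<Rightarrow> bool" where
  "left_affine x d \<longleftrightarrow> (\<exists>\<alpha>>0. \<exists>\<beta>. \<exists>\<epsilon>>0. \<forall>t. d - \<epsilon> < t \<and> t < d \<longrightarrow> x t = \<alpha> * t + \<beta>)"

text \<open>Elements of V may permute intervals, so only the germs of g at the two ends of the
  support are assumed affine. The germ at d leaves out d itself: when d = r that point is outside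
  [0,r), and its value says nothing about the last piece.\<close>

locale commuting_with_bump = standard_bump +
  fixes g :: "real \<Rightarrow> real" and \<mu> :: real
  assumes bij_g: "bij g" and comm: "g \<circ> X = X \<circ> g"
    and right: "right_affine g c \<mu>" and left: "left_affine g d"
begin

lemma g_fpow: "g (fpow X j t) = fpow X j (g t)"
  using fpow_commutes[OF bij comm, of j] by (metis o_apply)

lemma g_mem: "g t \<in> {c<..<d} \<longleftrightarrow> t \<in> {c<..<d}"
  by (rule commuting_mem_iff[OF bij_g comm])

lemma affine_near_left:
  obtains \<epsilon> where "\<epsilon> > 0" "\<And>t. c \<le> t \<Longrightarrow> t < c + \<epsilon> \<Longrightarrow> g t = c + \<mu> * (t - c)"
  using right commuting_fix_left[OF bij_g comm right] unfolding right_affine_def by metis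

lemma slope_pos: "0 < \<mu>"
  using right by (simp add: right_affine_def)

lemma orbit_near_left:
  assumes "t \<in> {c<..<d}" "0 < \<epsilon>"
  obtains j where "c < fpow X j t" "fpow X j t < c + \<epsilon>"
proof -
  have "c + min (\<epsilon> / 2) ((d - c) / 2) \<in> {c<..<d}" using assms cuts by (auto simp: min_def field_simps)
  from unbounded_orbit_below[OF assms(1) this] obtain j where "fpow X j t < c + min (\<epsilon> / 2) ((d - c) / 2)" .
  then have "fpow X j t < c + \<epsilon>" using assms(2) by linarith
  moreover have "c < fpow X j t" using fpow_mem_iff[of j t] assms(1) by simp
  ultimately show ?thesis using that by blast
qed

text \<open>A power of \<open>X\<close> carries both points into the zone near c where g is affine
  with positive slope. Since g commutes with that power and powers of \<open>X\<close> preserve and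
  reflect order, the inequality comes back.\<close>

lemma g_mono:
  assumes "s \<in> {c<..<d}" "t \<in> {c<..<d}" "s < t" shows "g s < g t"
proof -
  obtain \<epsilon> where e: "\<epsilon> > 0" "\<And>t. c \<le> t \<Longrightarrow> t < c + \<epsilon> \<Longrightarrow> g t = c + \<mu> * (t - c)"
    using affine_near_left by blast
  obtain j where j: "c < fpow X j t" "fpow X j t < c + \<epsilon>" using orbit_near_left[OF assms(2) e(1)] .
  have s: "c < fpow X j s" "fpow X j s < fpow X j t" using fpow_mem_iff[of j s] assms fpow_mono by auto
  have "fpow X j (g s) < fpow X j (g t)"
    unfolding g_fpow[symmetric] using e(2)[of "fpow X j t"] e(2)[of "fpow X j s"] s j slope_pos by simp
  then show ?thesis by (simp add: fpow_less_iff)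
qed

text \<open>The same transport to c shows that the direction in which g moves any point of (c,d) is
  governed by the slope \<open>\<mu>\<close> at c alone. In particular, a g fixing one point of
  (c,d) fixes them all.\<close>

lemma g_sign:
  assumes t: "t \<in> {c<..<d}" shows "t < g t \<longleftrightarrow> 1 < \<mu>" "g t = t \<longleftrightarrow> \<mu> = 1"
proof -
  obtain \<epsilon> where e: "\<epsilon> > 0" "\<And>t. c \<le> t \<Longrightarrow> t < c + \<epsilon> \<Longrightarrow> g t = c + \<mu> * (t - c)"
    using affine_near_left by blast
  obtain j where j: "c < fpow X j t" "fpow X j t < c + \<epsilon>" using orbit_near_left[OF t e(1)] .
  have g: "fpow X j (g t) - fpow X j t = (\<mu> - 1) * (fpow X j t - c)"
    unfolding g_fpow[symmetric] using e(2)[of "fpow X j t"] j by (simp add: algebra_simps)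
  have "t < g t \<longleftrightarrow> 0 < fpow X j (g t) - fpow X j t" by (simp add: fpow_less_iff)
  also have "\<dots> \<longleftrightarrow> 1 < \<mu>" unfolding g using j by (simp add: zero_less_mult_iff)
  finally show "t < g t \<longleftrightarrow> 1 < \<mu>" .
  have "g t = t \<longleftrightarrow> fpow X j (g t) - fpow X j t = 0" 
    using bij_fpow[OF bij, of j] by (simp add: bij_def inj_eq)
  also have "\<dots> \<longleftrightarrow> \<mu> = 1" unfolding g using j by simp
  finally show "g t = t \<longleftrightarrow> \<mu> = 1" .
qed

text \<open>Near \<open>c\<close> and near \<open>d\<close> the map \<open>g\<close> is affine, so it carries kinks of \<open>X ^^ n\<close> close to \<open>c\<close>
  to kinks of \<open>X ^^ n\<close> as soon as \<open>n\<close> is so large that \<open>X ^^ n\<close> moves them close to \<open>d\<close>.\<close>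

lemma g_kink: obtains j where "g q1 = fpow X j q1 \<or> g q1 = fpow X j q2"
proof -
  obtain \<epsilon> where e: "\<epsilon> > 0" "\<And>t. c \<le> t \<Longrightarrow> t < c + \<epsilon> \<Longrightarrow> g t = c + \<mu> * (t - c)"
    using affine_near_left by blast
  obtain \<alpha> \<beta> \<delta> where a: "\<alpha> > 0" "\<delta> > 0" "\<And>t. d - \<delta> < t \<Longrightarrow> t < d \<Longrightarrow> g t = \<alpha> * t + \<beta>"
    using left unfolding left_affine_def by blast
  have q1: "q1 \<in> {c<..<d}" using cuts by auto
  \<comment> \<open>The bound \<open>\<epsilon>\<close> gives affinity of g around t. The bound u
    puts t to the left of \<open>q1\<close>, so j is negative and t reaches the kink after -j
    forward steps.\<close>
  have "0 < min \<epsilon> u" using e u by simp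
  from orbit_near_left[OF q1 this] obtain j where j: "c < fpow X j q1" "fpow X j q1 < c + min \<epsilon> u" .
  define t where "t = fpow X j q1"
  have t: "c < t" "t < c + \<epsilon>" "t < q1" "t < d" using j cuts by (auto simp: t_def)
  have "j < 0"
  proof (rule ccontr)
    assume "\<not> j < 0"
    then have "fpow X 0 q1 \<le> fpow X j q1" using fpow_mono_exponent[OF q1, of 0 j] by (cases "j = 0") auto
    then show False using j by simp
  qed
  define i where "i = nat (- j)"
  have i: "(X ^^ i) t = q1"
    using fpow_neg[OF bij, of j] \<open>j < 0\<close> unfolding i_def t_def
    by (metis fpow_of_nat int_nat_eq neg_0_less_iff_less less_imp_le o_apply id_apply)
  \<comment> \<open>Once X^n t1 lies beyond w, all points between t1 and d, and so a neighbourhood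
    of t, are moved by X^n into the zone near d where g is affine. Taking n > i also makes the orbit
    of t cross the kink.\<close>
  define t1 where "t1 = (c + t) / 2"
  have t1: "c < t1" "t1 < t" using t by (auto simp: t1_def)
  define w where "w = max ((c + d) / 2) (d - \<delta> / 2)"
  have w: "w \<in> {c<..<d}" "d - \<delta> < w" using a(2) cuts by (auto simp: w_def max_def field_simps)
  obtain k where k: "w < fpow X k t1" using unbounded_orbit[of t1 w] t1 t w(1) by auto
  define n where "n = max (nat k) (Suc i)"
  have t1in: "t1 \<in> {c<..<d}" using t1 t by auto
  have n: "i < n" "w < (X ^^ n) t1"
  proof -
    show "i < n" by (simp add: n_def)
    have "k \<le> int n" by (auto simp: n_def)
    then have "fpow X k t1 \<le> fpow X (int n) t1"
      using fpow_mono_exponent[OF t1in, of k "int n"] by (cases "k = int n") auto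
    then show "w < (X ^^ n) t1" using k by (simp add: fpow_of_nat)
  qed
  define s where "s = g t"
  have s: "s \<in> {c<..<d}" unfolding s_def g_mem using t by simp
  have gfun: "g ((X ^^ n) t) = (X ^^ n) (g t)" for n t
    using g_fpow[of "int n" t] by (simp only: fpow_of_nat)
  \<comment> \<open>Otherwise X^n is affine around s, so X^n after g, which equals g after X^n, is
    affine around t. Because g is affine with positive slope near d, X^n would then be affine around
    t, contradicting its strict concavity there.\<close>
  have "\<exists>m<n. (X ^^ m) s \<in> {q1, q2}"
  proof (rule ccontr)
    assume "\<not> (\<exists>m<n. (X ^^ m) s \<in> {q1, q2})"
    then obtain l where l: "\<forall>\<^sub>F h in nhds 0. (X ^^ n) (s + h) = (X ^^ n) s + l * h"
      using funpow_locally_affine[OF s, of n] by blast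
    have "((\<lambda>h. \<mu> * h) \<longlongrightarrow> 0) (nhds 0)" by (auto intro!: tendsto_eq_intros filterlim_ident)
    with l have l': "\<forall>\<^sub>F h in nhds 0. (X ^^ n) (s + \<mu> * h) = (X ^^ n) s + l * (\<mu> * h)"
      by (rule eventually_compose_filterlim)
    have near: "\<forall>\<^sub>F h in nhds 0. t1 < t + 1 * h \<and> t + 1 * h < min (c + \<epsilon>) d"
      by (rule eventually_near) (use t t1 in auto)
    have "\<forall>\<^sub>F h in nhds 0. t + h \<in> {c<..<d} \<and>
        \<alpha> * (X ^^ n) (t + h) + \<beta> = (X ^^ n) s + l * \<mu> * h"
      using l' near
    proof eventually_elim
      case (elim h)
      have th: "t + h \<in> {c<..<d}" using elim t1 by auto
      have "(X ^^ n) t1 < (X ^^ n) (t + h)" using elim funpow_less_iff by simp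
      then have "d - \<delta> < (X ^^ n) (t + h)" using n w by simp
      moreover have "(X ^^ n) (t + h) < d" using th funpow_mem_iff[of n "t + h"] by simp
      ultimately have "\<alpha> * (X ^^ n) (t + h) + \<beta> = (X ^^ n) (g (t + h))"
        using a(3)[of "(X ^^ n) (t + h)"] gfun[of n "t + h"] by linarith
      also have "g (t + h) = s + \<mu> * h"
        using e(2)[of "t + h"] e(2)[of t] elim th t unfolding s_def by (simp add: algebra_simps)
      finally show ?case using elim th by simp
    qed
    then obtain \<eta> where \<eta>: "\<eta> > 0" "\<And>h. \<bar>h\<bar> < \<eta> \<Longrightarrow> t + h \<in> {c<..<d} \<and>
        \<alpha> * (X ^^ n) (t + h) + \<beta> = (X ^^ n) s + l * \<mu> * h"
      unfolding eventually_nhds_metric dist_real_def by (metis diff_zero)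
    define h where "h = \<eta> / 2"
    have h: "0 < h" "\<bar>h\<bar> < \<eta>" "\<bar>- h\<bar> < \<eta>" using \<eta>(1) by (auto simp: h_def)
    have "(X ^^ n) (t - h) + (X ^^ n) (t + h) < 2 * (X ^^ n) t"
      using funpow_concave_kink[OF i n(1) h(1)] \<eta>(2)[OF h(2)] \<eta>(2)[OF h(3)] by simp
    then have "\<alpha> * ((X ^^ n) (t - h) + (X ^^ n) (t + h)) < \<alpha> * (2 * (X ^^ n) t)"
      using a(1) by simp
    moreover have "\<alpha> * (X ^^ n) (t - h) + \<beta> = (X ^^ n) s - l * \<mu> * h"
      "\<alpha> * (X ^^ n) (t + h) + \<beta> = (X ^^ n) s + l * \<mu> * h" "\<alpha> * (X ^^ n) t + \<beta> = (X ^^ n) s"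
      using \<eta>(2)[OF h(2)] \<eta>(2)[OF h(3)] \<eta>(2)[of 0] \<eta>(1) by auto
    ultimately show False by (simp add: distrib_left)
  qed
  then obtain m where m: "(X ^^ m) s = q1 \<or> (X ^^ m) s = q2" by blast
  have "g q1 = fpow X (int i) s" using gfun[of i t] i by (simp add: s_def fpow_of_nat)
  moreover have "s = fpow X (- int m) ((X ^^ m) s)"
    using fpow_neg[OF bij, of "int m"] by (metis fpow_of_nat o_apply id_apply)
  ultimately have "g q1 = fpow X (int i + - int m) ((X ^^ m) s)"
    by (metis fpow_add[OF bij] o_apply)
  with m show ?thesis using that by metis
qed

end

subsection \<open>Centralizers of bumps\<close>

text \<open>Discreteness comes from \<open>g_kink\<close>: few images of \<open>q1\<close> are
  possible, so a smallest positive displacement exists, and Euclidean division by the element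
  \<open>F\<close> attaining it exhausts \<open>H\<close>. The final conclusion serves later to show
  that the image of the kink lies in the module A.\<close>

lemma (in standard_bump) cyclic_centralizer:
  assumes H: "\<And>g. g \<in> H \<Longrightarrow> bij g \<and> g \<circ> X = X \<circ> g \<and> (\<exists>l. right_affine g c l) \<and>
      left_affine g d \<and> (\<forall>t. t \<notin> {c<..<d} \<longrightarrow> g t = t)"
    and X: "X \<in> H" and comp: "\<And>g h. g \<in> H \<Longrightarrow> h \<in> H \<Longrightarrow> g \<circ> h \<in> H"
    and inv: "\<And>g. g \<in> H \<Longrightarrow> inv g \<in> H"
  obtains F where "bump F c d" "H = range (fpow F)"
    "\<exists>j. F q1 = fpow X j q1 \<or> F q1 = fpow X j q2"
proof -
  have q1: "q1 \<in> {c<..<d}" using cuts by auto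
  have commuting: "\<exists>\<mu>. commuting_with_bump \<kappa> c d u g \<mu>" if "g \<in> H" for g
    using H[OF that] standard_bump_axioms
    by (auto simp: commuting_with_bump_def commuting_with_bump_axioms_def)
  \<comment> \<open>The interval (q1, X q1] is a fundamental domain of \<open>X\<close>, so it meets
    the orbit of \<open>q1\<close> only in X q1 and the orbit of \<open>q2\<close> at most once. By
    \<open>g_kink\<close> nothing else can occur in \<open>Y\<close>.\<close>
  define Y where "Y = {g q1 | g. g \<in> H \<and> q1 < g q1 \<and> g q1 \<le> X q1}"
  have "finite {y. q1 < y \<and> y \<le> X q1 \<and> (\<exists>j. y = fpow X j q2)}" (is "finite ?Z")
  proof -
    have le: "j \<le> k" if "q1 < fpow X k q2" "fpow X j q2 \<le> X q1" for j k
    proof (rule ccontr)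
      assume "\<not> j \<le> k"
      then have "k + 1 \<le> j" by simp
      have "X q1 < X (fpow X k q2)" using that mono by (simp add: strict_mono_less)
      also have "\<dots> = fpow X (k + 1) q2" by (simp add: fpow_Suc[OF bij])
      also have "\<dots> \<le> fpow X j q2"
        using fpow_mono_exponent[of q2 "k + 1" j] cuts \<open>k + 1 \<le> j\<close> by (cases "k + 1 = j") auto
      finally show False using that by simp
    qed
    have "y = z" if yz: "y \<in> ?Z" "z \<in> ?Z" for y z
    proof -
      obtain j k where jk: "y = fpow X j q2" "z = fpow X k q2" using yz by blast
      have "j = k" by (rule order_antisym; rule le) (use jk yz in auto)
      then show ?thesis using jk by simp
    qed
    then have "?Z = {} \<or> (\<exists>y. ?Z = {y})" by blast
    then show ?thesis by (elim disjE exE) (simp_all only: finite.emptyI finite_insert)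
  qed
  moreover have "Y \<subseteq> insert (X q1) ?Z"
  proof
    fix y assume "y \<in> Y"
    then obtain g where g: "g \<in> H" "y = g q1" "q1 < y" "y \<le> X q1" by (auto simp: Y_def)
    then obtain j where j: "y = fpow X j q1 \<or> y = fpow X j q2"
      using commuting commuting_with_bump.g_kink by metis
    have "y = X q1" if "y = fpow X j q1"
    proof -
      have "0 < j" using fpow_mono_exponent[OF q1, of j 0] g that by (cases j "0 :: int" rule: linorder_cases) auto
      moreover have "j \<le> 1"
      proof (rule ccontr)
        assume "\<not> j \<le> 1"
        then have "fpow X 1 q1 < fpow X j q1" by (intro fpow_mono_exponent[OF q1]) simp
        then show False using g that by simp
      qed
      ultimately have "j = 1" by simp
      then show ?thesis using that by simp
    qed
    then show "y \<in> insert (X q1) ?Z" using j g by blast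
  qed
  ultimately have fin: "finite Y" by (meson finite_insert finite_subset)
  have "X q1 \<in> Y" using X up[OF q1] by (auto simp: Y_def)
  then have "Min Y \<in> Y" using fin by (intro Min_in) auto
  then obtain F where F: "F \<in> H" "F q1 = Min Y" "q1 < F q1" "F q1 \<le> X q1" unfolding Y_def by force
  obtain \<mu> where "commuting_with_bump \<kappa> c d u F \<mu>" using commuting[OF F(1)] by blast
  then interpret F: commuting_with_bump \<kappa> c d u F \<mu> .
  have out: "F t = t" if "t \<notin> {c<..<d}" for t using H[OF F(1)] that by blast
  have bump: "bump F c d"
  proof
    show "strict_mono F"
    proof (rule strict_monoI)
      fix s t :: real assume "s < t"
      then show "F s < F t"
        using F.g_mono[of s t] out[of s] out[of t] F.g_mem[of s] F.g_mem[of t]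
        by (cases "s \<in> {c<..<d}"; cases "t \<in> {c<..<d}") auto
    qed
    show "surj F" using F.bij_g by (rule bij_is_surj)
    show "t < F t" if "t \<in> {c<..<d}" for t
      using F.g_sign(1)[OF q1] F.g_sign(1)[OF that] F(3) by simp
  qed (use out cuts in auto)
  then interpret FB: bump F c d .
  have id: "id \<in> H"
    using comp[OF inv[OF X] X] bij by (simp add: bij_def)
  have powers: "fpow F j \<in> H" for j
  proof (induction j rule: int_induct[where k = 0])
    case (step1 j)
    show ?case using comp[OF F(1) step1(2)] by (simp only: fpow_Suc[OF F.bij_g])
  next
    case (step2 j)
    have "fpow F (j - 1) = inv F \<circ> fpow F j"
      using fpow_Suc[OF F.bij_g, of "j - 1"] F.bij_g by (simp add: fun_eq_iff bij_def)
    then show ?case using comp[OF inv[OF F(1)] step2(2)] by (simp only:)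
  qed (use id in \<open>simp only: fpow_0\<close>)
  have "g \<in> range (fpow F)" if g: "g \<in> H" for g
  proof -
    obtain \<nu> where "commuting_with_bump \<kappa> c d u g \<nu>" using commuting[OF g] by blast
    then interpret g: commuting_with_bump \<kappa> c d u g \<nu> .
    have "g q1 \<in> {c<..<d}" using g.g_mem q1 by blast
    from FB.orbit_between[OF q1 this]
    obtain j where j: "fpow F j q1 \<le> g q1" "g q1 < fpow F (j + 1) q1" .
    \<comment> \<open>The remainder h sends \<open>q1\<close> into [q1, F q1). Minimality of F q1
      forces h to fix \<open>q1\<close>, and \<open>g_sign\<close> then makes h the
      identity.\<close>
    define h where "h = fpow F (- j) \<circ> g"
    have h: "h \<in> H" using comp[OF powers g] by (simp only: h_def)
    obtain \<rho> where "commuting_with_bump \<kappa> c d u h \<rho>" using commuting[OF h] by blast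
    then interpret h: commuting_with_bump \<kappa> c d u h \<rho> .
    have cancel: "fpow F (- j) (fpow F (j + i) t) = fpow F i t" for i t
      using fun_cong[OF fpow_add[OF F.bij_g, of "- j" "j + i"], of t] by simp
    have "q1 \<le> h q1" using FB.fpow_le[OF j(1), of "- j"] cancel[of 0] by (simp add: h_def)
    moreover have "h q1 < F q1" using FB.fpow_mono[OF j(2), of "- j"] cancel[of 1] by (simp add: h_def)
    moreover have "\<not> q1 < h q1"
    proof
      assume "q1 < h q1"
      then have "h q1 \<in> Y" using h \<open>h q1 < F q1\<close> F(4) by (auto simp: Y_def)
      then have "Min Y \<le> h q1" using fin by (intro Min_le)
      then show False using F(2) \<open>h q1 < F q1\<close> by simp
    qed
    ultimately have "h q1 = q1" by simp
    then have "\<rho> = 1" using h.g_sign(2)[OF q1] by simp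
    then have "h t = t" for t using h.g_sign(2)[of t] H[OF h] by (cases "t \<in> {c<..<d}") auto
    then have "fpow F (- j) (g t) = t" for t by (simp add: h_def)
    then have "g t = fpow F j t" for t
      using fun_cong[OF fpow_add[OF F.bij_g, of j "- j"], of "g t"] by simp
    then have "g = fpow F j" by (rule ext)
    then show ?thesis by blast
  qed
  then have "H = range (fpow F)" using powers by blast
  moreover obtain j where "F q1 = fpow X j q1 \<or> F q1 = fpow X j q2" using F.g_kink .
  ultimately show ?thesis using that bump by blast
qed

section \<open>Germs of elements of V, and standard bumps with data in A\<close>

lemma nth_bracket:
  fixes c :: real
  assumes "ps ! 0 \<le> c" "c < ps ! n"
  obtains i where "i < n" "ps ! i \<le> c" "c < ps ! Suc i"
proof -
  define k where "k = (LEAST k. c < ps ! k)"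
  have k: "c < ps ! k" unfolding k_def by (rule LeastI) (rule assms(2))
  have "k \<le> n" unfolding k_def by (rule Least_le) (rule assms(2))
  have "k \<noteq> 0" using k assms(1) by (intro notI) simp
  then obtain i where i: "k = Suc i" using not0_implies_Suc by blast
  then have "\<not> c < ps ! i" using not_less_Least[of i "\<lambda>k. c < ps ! k"] by (simp add: k_def)
  then show ?thesis using that[of i] i k \<open>k \<le> n\<close> by simp
qed

lemma Vset_pieces:
  assumes "x \<in> Vset r L B"
  obtains ps where "length ps \<ge> 2" "sorted_wrt (<) ps" "ps ! 0 = 0" "ps ! (length ps - 1) = r"
    "\<And>i. Suc i < length ps \<Longrightarrow> \<exists>l\<in>L. \<exists>b. \<forall>t\<in>{ps ! i..<ps ! Suc i}. x t = l * t + b"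
proof -
  obtain ps where ps: "length ps \<ge> 2" "sorted_wrt (<) ps" "hd ps = 0" "last ps = r"
    "\<And>i. Suc i < length ps \<Longrightarrow> \<exists>l\<in>L. \<exists>b. \<forall>t\<in>{ps ! i..<ps ! Suc i}. x t = l * t + b"
    using assms unfolding Vset_def by blast
  then have "ps \<noteq> []" by auto
  with ps show ?thesis using that[of ps] by (simp add: hd_conv_nth last_conv_nth)
qed

lemma Vset_right_affine:
  assumes x: "x \<in> Vset r {0<..} B" and c: "0 \<le> c" "c < r"
  shows "\<exists>l. right_affine x c l"
proof -
  obtain ps where ps: "length ps \<ge> 2" "ps ! 0 = 0" "ps ! (length ps - 1) = r"
    "\<And>i. Suc i < length ps \<Longrightarrow> \<exists>l\<in>{0<..}. \<exists>b. \<forall>t\<in>{ps ! i..<ps ! Suc i}. x t = l * t + b"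
    using Vset_pieces[OF x] by metis
  obtain i where i: "i < length ps - 1" "ps ! i \<le> c" "c < ps ! Suc i"
    using nth_bracket[of ps c "length ps - 1"] ps c by auto
  then have "Suc i < length ps" by simp
  from ps(4)[OF this] obtain l b where lb: "l > 0" "\<And>t. ps ! i \<le> t \<Longrightarrow> t < ps ! Suc i \<Longrightarrow> x t = l * t + b"
    by auto
  have "x t = x c + l * (t - c)" if "c \<le> t \<and> t < c + (ps ! Suc i - c)" for t
    using lb(2)[of t] lb(2)[of c] that i by (simp add: algebra_simps)
  moreover have "0 < ps ! Suc i - c" using i by simp
  ultimately show ?thesis using lb(1) unfolding right_affine_def by blast
qed

lemma Vset_left_affine:
  assumes x: "x \<in> Vset r {0<..} B"
  shows "left_affine x r"
proof -
  obtain ps where ps: "length ps \<ge> 2" "sorted_wrt (<) ps" "ps ! (length ps - 1) = r"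
    "\<And>i. Suc i < length ps \<Longrightarrow> \<exists>l\<in>{0<..}. \<exists>b. \<forall>t\<in>{ps ! i..<ps ! Suc i}. x t = l * t + b"
    using Vset_pieces[OF x] by metis
  define i where "i = length ps - 2"
  have i: "Suc i < length ps" "Suc i = length ps - 1" using ps(1) by (auto simp: i_def)
  then obtain l b where lb: "l > 0" "\<And>t. ps ! i \<le> t \<Longrightarrow> t < r \<Longrightarrow> x t = l * t + b"
    using ps(4)[of i] ps(3) by auto
  have "ps ! i < r" using sorted_wrt_nth_less[OF ps(2), of i "Suc i"] i ps(3) by simp
  then show ?thesis using lb unfolding left_affine_def
    by (intro exI[of _ l] conjI exI[of _ b] exI[of _ "r - ps ! i"]) auto
qed

lemma Vset_outside: "x \<in> Vset r L B \<Longrightarrow> t \<notin> {0..<r} \<Longrightarrow> x t = t"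
  by (simp add: Vset_def)

text \<open>Extension by the identity gives bijections of the whole line, so \<open>inv\<close>
  really is the inverse in the group.\<close>

lemma Vset_bij:
  assumes "x \<in> Vset r L B" shows "bij x"
proof -
  have b: "bij_betw x {0..<r} {0..<r}" and o: "\<And>t. t \<notin> {0..<r} \<Longrightarrow> x t = t"
    using assms by (auto simp: Vset_def)
  have "bij_betw x (- {0..<r}) (- {0..<r})"
    using o by (intro bij_betw_cong[THEN iffD2, OF _ bij_betw_id]) auto
  from bij_betw_combine[OF b this] show ?thesis by (simp add: Un_commute Compl_partition)
qed

lemma (in standard_bump) in_Fset:
  assumes adm: "admissible r L A" and "\<kappa> \<in> L" "c \<in> A" "d \<in> A" "u \<in> A" "0 \<le> c" "d \<le> r"
  shows "X \<in> Fset r L A"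
proof -
  have A: "0 \<in> A" "r \<in> A" "\<And>a b. a \<in> A \<Longrightarrow> b \<in> A \<Longrightarrow> a + b \<in> A" "\<And>a. a \<in> A \<Longrightarrow> - a \<in> A"
    "\<And>l a. l \<in> L \<Longrightarrow> a \<in> A \<Longrightarrow> l * a \<in> A" and L: "1 \<in> L" "1 / \<kappa> \<in> L"
    using adm \<open>\<kappa> \<in> L\<close>
    by (auto simp: admissible_def mult_subgroup_def add_subgroup_def inverse_eq_divide)
  have qA: "q1 \<in> A" "q2 \<in> A" "c + \<kappa> * u \<in> A" "d - u \<in> A"
    using A assms by (auto simp: diff_conv_add_uminus simp del: add_uminus_conv_diff)
  define P where "P s t \<longleftrightarrow> X s \<in> A \<and> (\<exists>l\<in>L. \<exists>b. \<forall>v\<in>{s..<t}. X v = l * v + b)" for s t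
  have Xq: "X q1 = c + \<kappa> * u" "X q2 = d - u" "X c = c" "X d = d" "X 0 = 0" "X r = r"
    using pieces(1)[of q1] pieces(3)[of q2] pieces(4) cuts u slope assms by auto
  have P1: "P c q1" unfolding P_def using Xq assms
    by (auto intro!: bexI[of _ \<kappa>] exI[of _ "c - \<kappa> * c"] simp: pieces(1) algebra_simps)
  have P2: "P q1 q2" unfolding P_def using Xq qA L
    by (auto intro!: bexI[of _ 1] exI[of _ "(\<kappa> - 1) * u"] simp: pieces(2))
  have P3: "P q2 d" unfolding P_def using Xq qA L
    by (auto intro!: bexI[of _ "1 / \<kappa>"] exI[of _ "d - d / \<kappa>"] simp: pieces(3) diff_divide_distrib)
  have P0: "P 0 c" "P d r" unfolding P_def using Xq assms A L
    by (auto intro!: bexI[of _ 1] exI[of _ 0] simp: pieces(4))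
  \<comment> \<open>The cuts are 0, c, q1, q2, d, r. When c = 0 or d = r the coinciding entries are
    merged, since the list must be strictly increasing.\<close>
  define ps where "ps = (if c = 0 then [0] else [0, c]) @ [q1, q2] @ (if d = r then [r] else [d, r])"
  have "successively P ps" using P0 P1 P2 P3 by (auto simp: ps_def)
  then have "\<forall>i. Suc i < length ps \<longrightarrow> P (ps ! i) (ps ! Suc i)" by (simp add: successively_conv_nth)
  moreover have "length ps \<ge> 2" "sorted_wrt (<) ps" "hd ps = 0" "last ps = r" "set ps \<subseteq> A"
    using A qA assms cuts by (auto simp: ps_def)
  moreover have "bij_betw X {0..<r} {0..<r}"
  proof -
    have iff: "X t \<in> {0..<r} \<longleftrightarrow> t \<in> {0..<r}" for t
      using strict_mono_less_eq[OF mono, of 0 t] strict_mono_less[OF mono, of t r] Xq by simp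
    show ?thesis
    proof (rule bij_betw_imageI)
      show "inj_on X {0..<r}" using bij by (auto simp: bij_def intro: inj_on_subset)
      show "X ` {0..<r} = {0..<r}"
      proof (intro equalityI subsetI)
        fix y assume y: "y \<in> {0..<r}"
        obtain t where t: "y = X t" using surj by (rule surjE)
        then have "t \<in> {0..<r}" using y iff by blast
        then show "y \<in> X ` {0..<r}" using t by blast
      qed (use iff in blast)
    qed
  qed
  moreover have "continuous_on {0..<r} X"
  proof (rule continuous_on_subset)
    show "continuous_on UNIV X"
      by (rule continuous_onI_mono) (use surj mono in \<open>auto simp: strict_mono_less_eq\<close>)
  qed simp
  moreover have "\<forall>t. t \<notin> {0..<r} \<longrightarrow> X t = t" using pieces(4) assms by auto
  ultimately show ?thesis unfolding Fset_def Vset_def P_def by blast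
qed

text \<open>The module A is closed under multiplication by \<open>\<kappa>\<close> and its inverse,
  so \<open>X\<close> maps A to A; so does its inverse, by the explicit formula of
  \<open>preimage\<close>.\<close>

lemma (in standard_bump) orbit_in_module:
  assumes adm: "admissible r L A" and "\<kappa> \<in> L" "c \<in> A" "d \<in> A" "u \<in> A" and t: "t \<in> A"
  shows "fpow X j t \<in> A"
proof -
  have A: "\<And>a b. a \<in> A \<Longrightarrow> b \<in> A \<Longrightarrow> a + b \<in> A" "\<And>a. a \<in> A \<Longrightarrow> - a \<in> A"
    "\<And>l a. l \<in> L \<Longrightarrow> a \<in> A \<Longrightarrow> l * a \<in> A" and L: "inverse \<kappa> \<in> L"
    using adm \<open>\<kappa> \<in> L\<close> by (auto simp: admissible_def mult_subgroup_def add_subgroup_def)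
  have sub: "a - b \<in> A" if "a \<in> A" "b \<in> A" for a b using A(1)[OF that(1) A(2)[OF that(2)]] by simp
  have div: "a / \<kappa> \<in> A" if "a \<in> A" for a using A(3)[OF L that] by (simp add: field_simps)
  have mul: "\<kappa> * a \<in> A" if "a \<in> A" for a using A(3)[OF assms(2) that] .
  have ku: "(\<kappa> - 1) * u \<in> A" using sub[OF mul[OF assms(5)] assms(5)] by (simp add: left_diff_distrib)
  have fwd: "X s \<in> A" if "s \<in> A" for s
    using that assms(3,4) ku by (auto simp: std_bump_def min_def intro!: A(1) sub mul div)
  have bwd: "s \<in> A" if "X s \<in> A" for s
  proof (cases "X s \<in> {c..d}")
    case True
    define y where "y = X s"
    define w where "w = max (c + (y - c) / \<kappa>) (max (y - (\<kappa> - 1) * u) (d - \<kappa> * (d - y)))"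
    have "w \<in> A" using that assms(3,4) ku by (auto simp: w_def y_def max_def intro!: A(1) sub mul div)
    moreover have "X w = X s" using preimage[of y] True by (simp add: w_def y_def)
    then have "w = s" using bij by (simp add: bij_def inj_eq)
    ultimately show ?thesis by simp
  next
    case False
    then have "X (X s) = X s" by (intro pieces(4)) auto
    then have "X s = s" using bij by (simp add: bij_def inj_eq)
    then show ?thesis using that by simp
  qed
  show ?thesis
  proof (induction j rule: int_induct[where k = 0])
    case (step1 j)
    then show ?case using fwd by (simp add: fpow_Suc[OF bij])
  next
    case (step2 j)
    have "fpow X j t = X (fpow X (j - 1) t)" using fpow_Suc[OF bij, of "j - 1"] by (simp add: fun_eq_iff)
    then show ?case using bwd step2 by simp
  qed (use t in simp)
qed

lemma exists_standard_bump:
  assumes adm: "admissible r L A" and k: "\<kappa> \<in> L" "1 < \<kappa>" and cd: "c \<in> A" "d \<in> A" "c < d"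
  obtains u where "u \<in> A" "standard_bump \<kappa> c d u"
proof -
  have A: "\<And>a b. a \<in> A \<Longrightarrow> b \<in> A \<Longrightarrow> a + b \<in> A" "\<And>a. a \<in> A \<Longrightarrow> - a \<in> A"
    "\<And>l a. l \<in> L \<Longrightarrow> a \<in> A \<Longrightarrow> l * a \<in> A" and L: "inverse \<kappa> \<in> L"
    using adm k(1) by (auto simp: admissible_def mult_subgroup_def add_subgroup_def)
  \<comment> \<open>Dividing d - c by a power of \<open>\<kappa>\<close> stays in A and becomes
    arbitrarily small; an exponent with \<open>\<kappa>\<close> ^ n > 1 + \<open>\<kappa>\<close>
    already gives the required room.\<close>
  obtain n where n: "1 + \<kappa> < \<kappa> ^ n" using real_arch_pow[OF k(2)] by blast
  define u where "u = inverse \<kappa> ^ n * (d - c)"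
  have pos: "0 < \<kappa> ^ n" using k(2) by simp
  have "inverse \<kappa> ^ m * (d - c) \<in> A" for m
  proof (induction m)
    case 0
    then show ?case using A(1)[OF cd(2) A(2)[OF cd(1)]] by simp
  next
    case (Suc m)
    then show ?case using A(3)[OF L] by (simp add: mult.assoc)
  qed
  then have "u \<in> A" by (simp add: u_def)
  moreover have "(1 + \<kappa>) * u < d - c"
  proof -
    have "(1 + \<kappa>) * u = (1 + \<kappa>) / \<kappa> ^ n * (d - c)" by (simp add: u_def field_simps)
    also have "\<dots> < 1 * (d - c)" using n pos cd by (intro mult_strict_right_mono) auto
    finally show ?thesis by simp
  qed
  moreover have "0 < u" using pos cd k by (simp add: u_def)
  ultimately show ?thesis using that k(2) by (simp add: standard_bump_def)
qed

subsection \<open>Moments of finitely supported sequences\<close>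

lemma shift_sums:
  fixes U :: "int \<Rightarrow> real"
  assumes fin: "finite {i. U i \<noteq> 0}"
  shows "Sum_any (\<lambda>i. U (i - n)) = Sum_any (\<lambda>i. U i)"
    and "Sum_any (\<lambda>i. of_int i * U (i - n)) = Sum_any (\<lambda>i. of_int i * U i) + of_int n * Sum_any (\<lambda>i. U i)"
    and "finite {i. U (i - n) \<noteq> 0}"
proof -
  have bij: "bij (\<lambda>i::int. i + n)"
    by (rule o_bij[of "\<lambda>i. i - n"]) auto
  show "Sum_any (\<lambda>i. U (i - n)) = Sum_any (\<lambda>i. U i)"
    by (rule Sum_any.reindex_cong[OF bij]) (auto simp: fun_eq_iff)
  have "{i. U (i - n) \<noteq> 0} = (\<lambda>i. i + n) ` {i. U i \<noteq> 0}"
    by (force simp: image_iff)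
  then show "finite {i. U (i - n) \<noteq> 0}" using fin by simp
  have "Sum_any (\<lambda>i. of_int i * U (i - n)) = Sum_any (\<lambda>i. of_int i * U i + of_int n * U i)"
    by (rule Sum_any.reindex_cong[OF bij]) (auto simp: fun_eq_iff algebra_simps)
  also have "\<dots> = Sum_any (\<lambda>i. of_int i * U i) + Sum_any (\<lambda>i. of_int n * U i)"
    by (rule Sum_any.distrib; rule finite_subset[OF _ fin]) auto
  also have "Sum_any (\<lambda>i. of_int n * U i) = of_int n * Sum_any (\<lambda>i. U i)"
    by (rule Sum_any_right_distrib[OF fin, symmetric])
  finally show "Sum_any (\<lambda>i. of_int i * U (i - n)) = Sum_any (\<lambda>i. of_int i * U i) + of_int n * Sum_any (\<lambda>i. U i)" .
qed

lemma moments_eq: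
  fixes \<alpha> \<beta> U V :: "int \<Rightarrow> real"
  assumes fin: "finite {i. \<alpha> i \<noteq> 0}" "finite {i. \<beta> i \<noteq> 0}" "finite {i. U i \<noteq> 0}" "finite {i. V i \<noteq> 0}"
    and eq: "\<And>i. \<alpha> (i - j) + U i = \<beta> i + V (i - k)"
  shows "Sum_any (\<lambda>i. \<alpha> i) + Sum_any (\<lambda>i. U i) = Sum_any (\<lambda>i. \<beta> i) + Sum_any (\<lambda>i. V i)"
    and "Sum_any (\<lambda>i. of_int i * \<alpha> i) + of_int j * Sum_any (\<lambda>i. \<alpha> i) + Sum_any (\<lambda>i. of_int i * U i) =
      Sum_any (\<lambda>i. of_int i * \<beta> i) + (Sum_any (\<lambda>i. of_int i * V i) + of_int k * Sum_any (\<lambda>i. V i))"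
proof -
  have sub: "finite {i. of_int i * f i \<noteq> 0}" if "finite {i. f i \<noteq> 0}" for f :: "int \<Rightarrow> real"
    by (rule finite_subset[OF _ that]) auto
  note f\<alpha> = shift_sums[OF fin(1), of j] and fV = shift_sums[OF fin(4), of k]
  have "Sum_any (\<lambda>i. \<alpha> (i - j)) + Sum_any (\<lambda>i. U i) = Sum_any (\<lambda>i. \<alpha> (i - j) + U i)"
    by (rule Sum_any.distrib[symmetric]) (use f\<alpha> fin in auto)
  also have "\<dots> = Sum_any (\<lambda>i. \<beta> i + V (i - k))" using eq by simp
  also have "\<dots> = Sum_any (\<lambda>i. \<beta> i) + Sum_any (\<lambda>i. V (i - k))"
    by (rule Sum_any.distrib) (use fV fin in auto)
  finally show "Sum_any (\<lambda>i. \<alpha> i) + Sum_any (\<lambda>i. U i) = Sum_any (\<lambda>i. \<beta> i) + Sum_any (\<lambda>i. V i)" using f\<alpha> fV by simp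
  have "Sum_any (\<lambda>i. of_int i * \<alpha> (i - j)) + Sum_any (\<lambda>i. of_int i * U i) = Sum_any (\<lambda>i. of_int i * \<alpha> (i - j) + of_int i * U i)"
    by (rule Sum_any.distrib[symmetric]) (use f\<alpha> fin sub in auto)
  also have "\<dots> = Sum_any (\<lambda>i. of_int i * \<beta> i + of_int i * V (i - k))"
    using eq by (simp flip: distrib_left)
  also have "\<dots> = Sum_any (\<lambda>i. of_int i * \<beta> i) + Sum_any (\<lambda>i. of_int i * V (i - k))"
    by (rule Sum_any.distrib) (use fV fin sub in auto)
  finally show "Sum_any (\<lambda>i. of_int i * \<alpha> i) + of_int j * Sum_any (\<lambda>i. \<alpha> i) + Sum_any (\<lambda>i. of_int i * U i) =
      Sum_any (\<lambda>i. of_int i * \<beta> i) + (Sum_any (\<lambda>i. of_int i * V i) + of_int k * Sum_any (\<lambda>i. V i))" using f\<alpha> fV by simp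
qed

text \<open>Shifting by n keeps the sum and adds n times the sum to the first moment. First moments
  of the first two equations give j M = k N and l M = N', where M, N, N' are the sums of
  \<open>\<alpha>\<close>, U, S. The third equation gives N = N' on comparing sums, and M can be
  cancelled.\<close>

lemma product_of_moments:
  fixes \<alpha> U S W :: "int \<Rightarrow> real"
  assumes fin: "finite {i. \<alpha> i \<noteq> 0}" "finite {i. U i \<noteq> 0}" "finite {i. S i \<noteq> 0}" "finite {i. W i \<noteq> 0}"
    and "\<And>i. \<alpha> (i - j) + U i = \<alpha> i + U (i - k)"
    and "\<And>i. \<alpha> (i - l) + S i = \<alpha> i + S (i - 1)"
    and "\<And>i. U i + W i = S i + W (i - 1)"
    and nonzero: "Sum_any (\<lambda>i. \<alpha> i) \<noteq> 0"
  shows "j = k * l"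
proof -
  have "of_int j * Sum_any (\<lambda>i. \<alpha> i) = of_int k * Sum_any (\<lambda>i. U i)"
    using moments_eq(2)[OF fin(1,1,2,2), of j k] assms by simp
  moreover have "of_int l * Sum_any (\<lambda>i. \<alpha> i) = Sum_any (\<lambda>i. S i)"
    using moments_eq(2)[OF fin(1,1,3,3), of l 1] assms by simp
  moreover have "Sum_any (\<lambda>i. U i) = Sum_any (\<lambda>i. S i)"
    using moments_eq(1)[OF fin(2,3,4,4), of 0 1] assms by simp
  ultimately have "of_int j * Sum_any (\<lambda>i. \<alpha> i) = of_int (k * l) * Sum_any (\<lambda>i. \<alpha> i)" by simp
  then have "(of_int j :: real) = of_int (k * l)" using nonzero mult_right_cancel by blast
  then show ?thesis by (simp only: of_int_eq_iff)
qed

section \<open>Witnesses for products in an abelian monoid with a shift\<close>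

locale shifted_monoid =
  fixes B :: "'a set" and m :: "'a \<Rightarrow> 'a \<Rightarrow> 'a" (infixl "\<cdot>" 70) and e :: 'a and T :: "int \<Rightarrow> 'a \<Rightarrow> 'a"
  assumes closed: "x \<in> B \<Longrightarrow> y \<in> B \<Longrightarrow> x \<cdot> y \<in> B" and e: "e \<in> B" "e \<cdot> x = x"
    and assoc: "x \<cdot> y \<cdot> z = x \<cdot> (y \<cdot> z)" and comm: "x \<in> B \<Longrightarrow> y \<in> B \<Longrightarrow> x \<cdot> y = y \<cdot> x"
    and T: "x \<in> B \<Longrightarrow> T j x \<in> B" "T j (x \<cdot> y) = T j x \<cdot> T j y" "T j (T k x) = T (j + k) x"
      "T 0 x = x" "T j e = e"
begin

lemma lcomm: "x \<in> B \<Longrightarrow> y \<in> B \<Longrightarrow> x \<cdot> (y \<cdot> z) = y \<cdot> (x \<cdot> z)"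
  by (metis assoc comm)

lemmas ac = assoc comm lcomm

text \<open>In additive notation this divides t^(j+i) a - t^j a by t - 1: the witness is the
  telescoping sum of t^m a over m from j to j + i - 1.\<close>

lemma difference_witness:
  assumes a: "a \<in> B"
  shows "\<exists>w\<in>B. w \<cdot> T (j + int i) a = T j a \<cdot> T 1 w"
proof (induction i)
  case 0
  have "e \<cdot> T j a = T j a \<cdot> e" using e T(1)[OF a] comm by blast
  then show ?case using e T(5) by (intro bexI[of _ e]) auto
next
  case (Suc i)
  then obtain w where w: "w \<in> B" "w \<cdot> T (j + int i) a = T j a \<cdot> T 1 w" by blast
  have T1: "T 1 (T (j + int i) a) = T (j + int (Suc i)) a" by (simp add: T(3) algebra_simps)
  show ?case
  proof (intro bexI)
    show "w \<cdot> T (j + int i) a \<cdot> T (j + int (Suc i)) a = T j a \<cdot> T 1 (w \<cdot> T (j + int i) a)"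
      unfolding T(2) T1 unfolding w(2) by (rule assoc)
  qed (use w a T(1) closed in blast)
qed

text \<open>Additively, for k > 0 take u as the sum of t^(k m) a and s as the sum of t^m a, both
  over m < l. Then u - s is a sum of terms (t^(k m) - t^m) a, each divisible by t - 1. For k = 0 the
  condition on u is vacuous, and u = s works with trivial w.\<close>

lemma product_witness:
  assumes a: "a \<in> B"
  shows "\<exists>u\<in>B. \<exists>s\<in>B. \<exists>w\<in>B. u \<cdot> T (int (k * l)) a = a \<cdot> T (int k) u \<and>
    s \<cdot> T (int l) a = a \<cdot> T 1 s \<and> w \<cdot> u = T 1 w \<cdot> s"
proof (cases "k = 0")
  case True
  obtain s where s: "s \<in> B" "s \<cdot> T (int l) a = a \<cdot> T 1 s"
    using difference_witness[OF a, of 0 l] by (auto simp: T(4))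
  have "s \<cdot> T (int (k * l)) a = a \<cdot> T (int k) s" using True comm[OF s(1) a] by (simp add: T(4))
  moreover have "e \<cdot> s = T 1 e \<cdot> s" by (simp add: T(5))
  ultimately show ?thesis using s e by blast
next
  case False
  show ?thesis
  proof (induction l)
    case 0
    have "e \<cdot> a = a \<cdot> e" using e a comm by blast
    then show ?case using e by (intro bexI[of _ e]) (auto simp: T(4,5))
  next
    case (Suc l)
    then obtain u s w where usw: "u \<in> B" "s \<in> B" "w \<in> B"
      "u \<cdot> T (int (k * l)) a = a \<cdot> T (int k) u" "s \<cdot> T (int l) a = a \<cdot> T 1 s" "w \<cdot> u = T 1 w \<cdot> s"
      by blast
    \<comment> \<open>The new term of u - s is (t^(k l) - t^l) a; since k > 0 its exponents are in
      the order that \<open>difference_witness\<close> expects. The resulting v is added to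
      w.\<close>
    have "int (k * l) = int l + int (k * l - l)" using False by (simp add: of_nat_diff)
    then obtain v where v: "v \<in> B" "v \<cdot> T (int (k * l)) a = T (int l) a \<cdot> T 1 v"
      using difference_witness[OF a, of "int l" "k * l - l"] by auto
    define A where "A j = T (int j) a" for j :: nat
    have A: "A j \<in> B" for j using T(1)[OF a] by (simp add: A_def)
    have TA: "T (int j) (A i) = A (j + i)" "T 1 (A i) = A (Suc i)" for i j
      by (simp_all add: A_def T(3))
    note usw' = usw(4-6)[folded A_def] and v' = v(2)[folded A_def]
    have TB: "T j u \<in> B" "T j s \<in> B" "T j w \<in> B" "T j v \<in> B" for j using T(1) usw v by auto
    have "u \<cdot> A (k * l) \<cdot> A (k * Suc l) = a \<cdot> T (int k) (u \<cdot> A (k * l))"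
      unfolding T(2) TA unfolding usw'(1) by (simp add: assoc)
    moreover have "s \<cdot> A l \<cdot> A (Suc l) = a \<cdot> T 1 (s \<cdot> A l)"
      unfolding T(2) TA unfolding usw'(2) by (simp add: assoc)
    moreover have "w \<cdot> v \<cdot> (u \<cdot> A (k * l)) = T 1 (w \<cdot> v) \<cdot> (s \<cdot> A l)"
    proof -
      have "w \<cdot> v \<cdot> (u \<cdot> A (k * l)) = (w \<cdot> u) \<cdot> (v \<cdot> A (k * l))"
        using usw(1-3) v(1) A by (simp add: ac closed)
      also have "\<dots> = T 1 (w \<cdot> v) \<cdot> (s \<cdot> A l)"
        unfolding usw'(3) v' T(2) using usw(1-3) v(1) A TB by (simp add: ac closed)
      finally show ?thesis .
    qed
    ultimately show ?case
      using usw(1-3) v(1) A closed unfolding A_def by blast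
  qed
qed

end

subsection \<open>Multiplication in a lamplighter subgroup\<close>

lemma bump_conj:
  assumes "bump X c d" and Y: "strict_mono Y" and YZ: "\<And>t. Y (Z t) = t" "\<And>t. Z (Y t) = t"
  shows "bump (Y \<circ> X \<circ> Z) (Y c) (Y d)"
proof -
  interpret bump X c d by fact
  have Z: "Z s < Z t \<longleftrightarrow> s < t" for s t using strict_mono_less[OF Y, of "Z s" "Z t"] YZ by simp
  have mem: "Z t \<in> {c<..<d} \<longleftrightarrow> t \<in> {Y c<..<Y d}" for t
    using Z[of "Y c" t] Z[of t "Y d"] YZ by simp
  show ?thesis
  proof
    show "strict_mono (Y \<circ> X \<circ> Z)"
      by (rule strict_monoI) (simp add: strict_mono_less[OF Y] strict_mono_less[OF mono] Z)
    show "surj (Y \<circ> X \<circ> Z)"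
      by (intro comp_surj surj surjI[of _ Y] surjI[of _ Z]) (use YZ in auto)
    show "Y c < Y d" using Y less by (simp add: strict_mono_less)
    show "(Y \<circ> X \<circ> Z) t = t" if "t \<notin> {Y c<..<Y d}" for t
    proof -
      have "X (Z t) = Z t" using fix_outside mem that by blast
      then show ?thesis by (simp add: YZ)
    qed
    show "t < (Y \<circ> X \<circ> Z) t" if "t \<in> {Y c<..<Y d}" for t
    proof -
      have "Z t < X (Z t)" using up mem that by blast
      then have "Y (Z t) < Y (X (Z t))" using Y by (simp only: strict_mono_less)
      then show ?thesis by (simp add: YZ)
    qed
  qed
qed

lemma disjoint_bumps_commute:
  assumes "bump X c d" "bump Y c' d'" "d \<le> c'"
  shows "X \<circ> Y = Y \<circ> X"
proof
  fix t
  interpret X: bump X c d by fact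
  interpret Y: bump Y c' d' by fact
  consider "t \<in> {c<..<d}" | "t \<in> {c'<..<d'}" | "t \<notin> {c<..<d}" "t \<notin> {c'<..<d'}" by blast
  then show "(X \<circ> Y) t = (Y \<circ> X) t"
  proof cases
    case 1
    then have "Y t = t" "Y (X t) = X t" using X.mem_iff[of t] assms(3) by (auto intro!: Y.fix_outside)
    then show ?thesis by simp
  next
    case 2
    then have "X t = t" "X (Y t) = Y t" using Y.mem_iff[of t] assms(3) by (auto intro!: X.fix_outside)
    then show ?thesis by simp
  next
    case 3
    then show ?thesis using X.fix_outside Y.fix_outside by simp
  qed
qed

definition right_slope :: "(real \<Rightarrow> real) \<Rightarrow> real \<Rightarrow> real" where
  "right_slope x c = (THE l. right_affine x c l)"

lemma right_slope_eq: "right_affine x c l \<Longrightarrow> right_slope x c = l"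
  unfolding right_slope_def using right_affine_unique by (intro the_equality) auto

lemma right_affine_fixed:
  assumes "c < d" "\<And>t. c \<le> t \<Longrightarrow> t < d \<Longrightarrow> x t = t"
  shows "right_affine x c 1"
  unfolding right_affine_def using assms by (intro conjI exI[of _ "d - c"]) auto

text \<open>The interval [p, F p) is a fundamental domain of \<open>F\<close> on (0,r),
  \<open>a\<close> is a bump inside it, and \<open>h\<close> is a bump to its left. Other elements
  of G enter only through their bijectivity and their affine germs.\<close>

locale thompson_coding =
  fixes G :: "(real \<Rightarrow> real) set" and r p :: real and F a h :: "real \<Rightarrow> real"
  assumes G: "id \<in> G" "\<And>x y. x \<in> G \<Longrightarrow> y \<in> G \<Longrightarrow> x \<circ> y \<in> G" "\<And>x. x \<in> G \<Longrightarrow> inv x \<in> G"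
    and bij_G: "\<And>x. x \<in> G \<Longrightarrow> bij x"
    and right_G: "\<And>x c. x \<in> G \<Longrightarrow> 0 \<le> c \<Longrightarrow> c < r \<Longrightarrow> \<exists>l. right_affine x c l"
    and left_G: "\<And>x. x \<in> G \<Longrightarrow> left_affine x r"
    and bump_F: "bump F 0 r" and centralizer: "{x \<in> G. x \<circ> F = F \<circ> x} = range (fpow F)"
    and p: "p \<in> {0<..<r}" and a: "a \<in> G" "bump a p (F p)" and h: "h \<in> G" "bump h 0 p"
begin

sublocale F: bump F 0 r by (rule bump_F)

lemma fpow_in_G: "fpow F j \<in> G"
  using centralizer by blast

lemma F_in_G: "F \<in> G"
  using fpow_in_G[of 1] by simp

lemma cancel: "fpow F (- j) (fpow F j t) = t" "fpow F j (fpow F (- j) t) = t"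
  using fun_cong[OF fpow_neg[OF F.bij, of j], of t] fun_cong[OF fpow_neg[OF F.bij, of "- j"], of t] by simp_all

lemma fpow_plus: "fpow F (j + k) t = fpow F j (fpow F k t)"
  by (simp add: fpow_add[OF F.bij])

lemma strict_mono_fpow: "strict_mono (fpow F j)"
  using F.fpow_mono by (rule strict_monoI)

definition T :: "int \<Rightarrow> (real \<Rightarrow> real) \<Rightarrow> real \<Rightarrow> real" where
  "T j x = fpow F j \<circ> x \<circ> fpow F (- j)"

lemma T_apply: "T j x t = fpow F j (x (fpow F (- j) t))"
  by (simp add: T_def)

lemma T_comp: "T j (x \<circ> y) = T j x \<circ> T j y"
  by (rule ext) (simp add: T_apply cancel)

lemma T_T: "T j (T k x) = T (j + k) x"
proof
  fix t
  have "fpow F (- (j + k)) t = fpow F (- k) (fpow F (- j) t)"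
    using fpow_plus[of "- k" "- j" t] by (simp add: add.commute)
  then show "T j (T k x) t = T (j + k) x t" by (simp only: T_apply fpow_plus)
qed

lemma T_0 [simp]: "T 0 x = x"
  by (rule ext) (simp add: T_apply)

lemma T_id: "T j id = id"
  by (rule ext) (simp add: T_apply cancel)

lemma T_in_G: "x \<in> G \<Longrightarrow> T j x \<in> G"
  unfolding T_def by (intro G fpow_in_G)

text \<open>Products are read left to right, so the group word g^-1 x g becomes the composition g
  after x after g^-1.\<close>

lemma T_eq: "Vmult (Vmult (inv (fpow F j)) x) (fpow F j) = T j x"
  by (simp only: Vmult_def T_def inv_fpow[OF F.bij] comp_assoc)

lemma T_commute: "T j x \<circ> y = y \<circ> T j x \<longleftrightarrow> x \<circ> T (- j) y = T (- j) y \<circ> x"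
proof -
  have "T (- j) (T j x \<circ> y) = x \<circ> T (- j) y" "T (- j) (y \<circ> T j x) = T (- j) y \<circ> x"
    by (simp_all only: T_comp T_T T_0 add.left_inverse)
  moreover have "T (- j) u = T (- j) v \<longleftrightarrow> u = v" for u v
    by (metis T_T T_0 add.right_inverse)
  ultimately show ?thesis by metis
qed

abbreviation P :: "int \<Rightarrow> real" where "P j \<equiv> fpow F j p"
abbreviation A :: "int \<Rightarrow> real \<Rightarrow> real" where "A j \<equiv> T j a"

lemma P_mem: "0 < P j" "P j < r"
  using F.fpow_mem_iff[of j p] p by auto

lemma P_mono: "j < k \<Longrightarrow> P j < P k"
  using F.fpow_mono_exponent p by blast

lemma P_le: "j \<le> k \<Longrightarrow> P j \<le> P k"
  using P_mono[of j k] by (cases "j = k") auto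

lemma bump_A: "bump (A j) (P j) (P (j + 1))"
proof -
  have "bump (A j) (fpow F j p) (fpow F j (F p))"
    unfolding T_def by (rule bump_conj[OF a(2) strict_mono_fpow]) (simp_all add: cancel)
  then show ?thesis using fpow_plus[of j 1 p] by simp
qed

definition cent :: "(real \<Rightarrow> real) \<Rightarrow> bool" where
  "cent x \<longleftrightarrow> (\<forall>j. x \<circ> A j = A j \<circ> x)"

text \<open>The center of the centralizer of all \<open>A j\<close>: unlike the group generated by the \<open>A j\<close> it is
  definable, while still being abelian and invariant under conjugation by \<open>F\<close>.\<close>

definition base :: "(real \<Rightarrow> real) set" where
  "base = {x \<in> G. cent x \<and> (\<forall>y\<in>G. cent y \<longrightarrow> x \<circ> y = y \<circ> x)}"

lemma cent_A: "cent (A k)"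
  unfolding cent_def
proof
  fix j
  consider "j = k" | "j + 1 \<le> k" | "k + 1 \<le> j" by linarith
  then show "A k \<circ> A j = A j \<circ> A k"
  proof cases
    case 2
    show ?thesis using disjoint_bumps_commute[OF bump_A[of j] bump_A[of k] P_le[OF 2]] by (rule sym)
  next
    case 3
    show ?thesis using disjoint_bumps_commute[OF bump_A[of k] bump_A[of j] P_le[OF 3]] .
  qed simp
qed

lemma cent_T: "cent x \<Longrightarrow> cent (T j x)"
  unfolding cent_def T_commute by (simp add: T_T)

lemma cent_comp: "cent x \<Longrightarrow> cent y \<Longrightarrow> cent (x \<circ> y)"
  unfolding cent_def by (simp add: fun_eq_iff)

sublocale base: shifted_monoid base "(\<circ>)" id T
proof
  fix x y j k
  show "x \<circ> y \<in> base" if "x \<in> base" "y \<in> base"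
  proof -
    have "x \<circ> y \<circ> z = z \<circ> (x \<circ> y)" if "z \<in> G" "cent z" for z
    proof -
      have xz: "x \<circ> z = z \<circ> x" and yz: "y \<circ> z = z \<circ> y"
        using \<open>x \<in> base\<close> \<open>y \<in> base\<close> that unfolding base_def by blast+
      have "x \<circ> y \<circ> z = x \<circ> (z \<circ> y)" unfolding comp_assoc yz ..
      also have "\<dots> = z \<circ> (x \<circ> y)" unfolding comp_assoc[symmetric] xz ..
      finally show ?thesis .
    qed
    then show ?thesis using that G(2) cent_comp unfolding base_def by blast
  qed
  show "id \<in> base" using G(1) by (simp add: base_def cent_def)
  show "x \<circ> y = y \<circ> x" if "x \<in> base" "y \<in> base" using that unfolding base_def by blast
  show "T j x \<in> base" if "x \<in> base"
  proof -
    have "T j x \<circ> y = y \<circ> T j x" if "y \<in> G" "cent y" for y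
      unfolding T_commute using \<open>x \<in> base\<close> T_in_G[OF that(1)] cent_T[OF that(2)] unfolding base_def by blast
    then show ?thesis using that T_in_G cent_T unfolding base_def by blast
  qed
qed (simp_all only: T_comp T_T T_0 T_id comp_assoc id_comp)

lemma a_in_base: "a \<in> base"
  unfolding base_def using a(1) cent_A[of 0] by (auto simp: cent_def dest: spec[of _ 0])

text \<open>P j is the left end of the support of \<open>A j\<close>, and
  \<open>commuting_fix_left\<close> applies even when x is discontinuous.\<close>

lemma cent_fixes:
  assumes "x \<in> G" "cent x" shows "x (P j) = P j"
proof -
  obtain l where "right_affine x (P j) l" using right_G[OF assms(1)] P_mem[of j] by force
  then show ?thesis
    using bump.commuting_fix_left[OF bump_A bij_G[OF assms(1)]] assms(2) unfolding cent_def by blast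
qed

definition log_slope :: "(real \<Rightarrow> real) \<Rightarrow> int \<Rightarrow> real" where
  "log_slope x j = ln (right_slope x (P j))"

lemma log_slope_eqI: "right_affine x (P j) l \<Longrightarrow> log_slope x j = ln l"
  by (simp add: log_slope_def right_slope_eq)

lemma right_affine_at_P: "x \<in> G \<Longrightarrow> \<exists>l>0. right_affine x (P j) l"
  using right_G[of x "P j"] P_mem[of j] unfolding right_affine_def by force

text \<open>This is the chain rule for right derivatives; the fixed point P j keeps both slopes at
  the same place, and the logarithm makes them add.\<close>

lemma log_slope_comp:
  assumes "x \<in> G" "cent x" "y \<in> G"
  shows "log_slope (y \<circ> x) j = log_slope y j + log_slope x j"
proof -
  obtain l l' where l: "l > 0" "right_affine x (P j) l" "l' > 0" "right_affine y (P j) l'"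
    using right_affine_at_P assms by metis
  then have "right_affine (y \<circ> x) (P j) (l' * l)"
    using right_affine_comp[OF l(2)] cent_fixes[OF assms(1,2)] by simp
  with l show ?thesis by (simp add: log_slope_eqI ln_mult)
qed

lemma log_slope_T:
  assumes "x \<in> G" "cent x"
  shows "log_slope (T k x) j = log_slope x (j - k)"
proof -
  have Pk: "fpow F (- k) (P j) = P (j - k)" using fpow_plus[of "- k" j p] by simp
  obtain l \<alpha> \<beta> where l: "l > 0" "right_affine x (P (j - k)) l"
    "\<alpha> > 0" "right_affine (fpow F (- k)) (P j) \<alpha>" "\<beta> > 0" "right_affine (fpow F k) (P (j - k)) \<beta>"
    using right_affine_at_P assms fpow_in_G by metis
  \<comment> \<open>The slopes of F^(-k) at P j and of F^k at P (j - k) multiply to 1, because the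
    composite is the identity. Conjugation therefore only moves the slope of x.\<close>
  have "right_affine (fpow F k \<circ> fpow F (- k)) (P j) (\<beta> * \<alpha>)"
    using right_affine_comp[OF l(4)] l(6) Pk by simp
  moreover have "right_affine (fpow F k \<circ> fpow F (- k)) (P j) 1"
    by (rule right_affine_fixed[of _ r]) (use P_mem cancel in auto)
  ultimately have one: "\<beta> * \<alpha> = 1" by (rule right_affine_unique)
  have "right_affine (x \<circ> fpow F (- k)) (P j) (l * \<alpha>)"
    using right_affine_comp[OF l(4)] l(2) Pk by simp
  moreover have "(x \<circ> fpow F (- k)) (P j) = P (j - k)" using Pk cent_fixes[OF assms] by simp
  ultimately have "right_affine (fpow F k \<circ> (x \<circ> fpow F (- k))) (P j) (\<beta> * (l * \<alpha>))"
    using right_affine_comp l(6) by metis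
  moreover have "\<beta> * (l * \<alpha>) = l" using one by (simp add: algebra_simps)
  ultimately have "right_affine (T k x) (P j) l" by (simp only: T_def comp_assoc)
  then show ?thesis using l(2) by (simp add: log_slope_eqI)
qed

lemma log_slope_a: "j \<noteq> 0 \<Longrightarrow> log_slope a j = 0" "0 < log_slope a 0"
proof -
  interpret a: bump a p "F p" by (rule a(2))
  show "log_slope a j = 0" if "j \<noteq> 0"
  proof -
    have "P j < P (j + 1)" by (rule P_mono) simp
    moreover have "a t = t" if "P j \<le> t" "t < P (j + 1)" for t
    proof -
      consider "j + 1 \<le> 0" | "1 \<le> j" using \<open>j \<noteq> 0\<close> by linarith
      then show ?thesis
      proof cases
        case 1
        then show ?thesis using P_le[OF 1] that by (intro a.fix_outside) auto
      next
        case 2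
        then show ?thesis using P_le[OF 2] that by (intro a.fix_outside) auto
      qed
    qed
    ultimately show ?thesis using log_slope_eqI[OF right_affine_fixed] by (metis ln_one)
  qed
  obtain l where l: "l > 0" "right_affine a (P 0) l" using right_affine_at_P[OF a(1)] by blast
  then obtain \<epsilon> where e: "\<epsilon> > 0" "\<And>t. p \<le> t \<and> t < p + \<epsilon> \<Longrightarrow> a t = a p + l * (t - p)"
    unfolding right_affine_def by auto
  define t where "t = p + min (\<epsilon> / 2) ((F p - p) / 2)"
  have t: "p < t" "t < p + \<epsilon>" "t < F p" using e(1) a.less by (auto simp: t_def min_def field_simps)
  have "a p = p" by (rule a.fix_outside) simp
  then have "t < p + l * (t - p)" using a.up[of t] e(2)[of t] t by simp
  then have "1 * (t - p) < l * (t - p)" by simp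
  then have "1 < l" using t(1) by (subst (asm) mult_less_cancel_right_pos) auto
  then show "0 < log_slope a 0" using log_slope_eqI[OF l(2)] by simp
qed

text \<open>Near 0, and likewise near r, x is given by one affine formula. All but finitely many P j
  lie in these two zones and are fixed by x; an affine map with two fixed points is the identity, so
  the slopes there are 1.\<close>

lemma finite_log_slope:
  assumes x: "x \<in> G" "cent x"
  shows "finite {j. log_slope x j \<noteq> 0}"
proof -
  have two_fixed: "\<alpha> = 1 \<and> \<beta> = 0" if "\<alpha> * s + \<beta> = s" "\<alpha> * t + \<beta> = t" "s < t" for \<alpha> \<beta> s t :: real
  proof -
    have "(\<alpha> - 1) * (t - s) = 0" using that by (simp add: algebra_simps)
    then show ?thesis using that by auto
  qed
  have r: "0 < r" using p by simp
  obtain l where "right_affine x 0 l" using right_G[OF x(1), of 0] r by auto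
  then obtain \<epsilon> where \<epsilon>: "\<epsilon> > 0" "\<And>t. 0 \<le> t \<and> t < 0 + \<epsilon> \<Longrightarrow> x t = x 0 + l * (t - 0)"
    unfolding right_affine_def by blast
  have "x t = l * t + x 0" if "0 \<le> t \<and> t < \<epsilon>" for t using \<epsilon>(2)[of t] that by simp
  note e = \<epsilon>(1) this
  have "min (\<epsilon> / 2) (r / 2) \<in> {0<..<r}" using e(1) r by (auto simp: min_def)
  from F.unbounded_orbit_below[OF p this] obtain j0 where "P j0 < min (\<epsilon> / 2) (r / 2)" .
  then have j0: "P j0 < \<epsilon>" using e(1) by simp
  have lo: "log_slope x j = 0" if "j \<le> j0" for j
  proof -
    have jl: "P (j - 1) < P j" by (rule P_mono) simp
    have "P j < \<epsilon>" using P_le[OF that] j0 by simp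
    then have "l = 1 \<and> x 0 = 0"
      using two_fixed[OF _ _ jl, of l "x 0"] e(2)[of "P j"] e(2)[of "P (j - 1)"] cent_fixes[OF x, of j]
        cent_fixes[OF x, of "j - 1"] P_mem[of j] P_mem[of "j - 1"] jl by simp
    then have "right_affine x (P j) 1"
      by (intro right_affine_fixed[OF \<open>P j < \<epsilon>\<close>]) (use e(2) P_mem[of j] \<open>l = 1 \<and> x 0 = 0\<close> in simp)
    then show ?thesis by (simp add: log_slope_eqI)
  qed
  obtain \<alpha> \<beta> \<delta> where d: "\<delta> > 0" "\<And>t. r - \<delta> < t \<and> t < r \<Longrightarrow> x t = \<alpha> * t + \<beta>"
    using left_G[OF x(1)] unfolding left_affine_def by blast
  have "max (r - \<delta> / 2) (r / 2) \<in> {0<..<r}" using d(1) r by (auto simp: max_def)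
  from F.unbounded_orbit[OF p this] obtain j1 where "max (r - \<delta> / 2) (r / 2) < P j1" .
  then have j1: "r - \<delta> < P j1" using d(1) by simp
  have hi: "log_slope x j = 0" if "j1 \<le> j" for j
  proof -
    have jl: "P j < P (j + 1)" by (rule P_mono) simp
    have lt: "r - \<delta> < P j" using P_le[OF that] j1 by simp
    then have "\<alpha> = 1 \<and> \<beta> = 0"
      using two_fixed[OF _ _ jl, of \<alpha> \<beta>] d(2)[of "P j"] d(2)[of "P (j + 1)"] cent_fixes[OF x, of j]
        cent_fixes[OF x, of "j + 1"] P_mem[of j] P_mem[of "j + 1"] jl by simp
    then have "right_affine x (P j) 1"
      by (intro right_affine_fixed[OF P_mem(2)]) (use d(2) lt \<open>\<alpha> = 1 \<and> \<beta> = 0\<close> in simp)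
    then show ?thesis by (simp add: log_slope_eqI)
  qed
  have "{j. log_slope x j \<noteq> 0} \<subseteq> {j0..j1}"
  proof
    fix j assume "j \<in> {j. log_slope x j \<noteq> 0}"
    then have "\<not> j \<le> j0" "\<not> j1 \<le> j" using lo hi by blast+
    then show "j \<in> {j0..j1}" by simp
  qed
  then show ?thesis by (rule finite_subset) simp
qed

text \<open>Taking logarithmic slopes turns \<open>T\<close> into a shift of integer sequences and
  composition into addition. The sequence of \<open>a\<close> is concentrated at index 0 with
  positive value, so its sum is nonzero.\<close>

lemma product_if_witness:
  assumes "u \<in> base" "s \<in> base" "w \<in> base"
    and eq: "u \<circ> A j = a \<circ> T k u" "s \<circ> A l = a \<circ> T 1 s" "w \<circ> u = T 1 w \<circ> s"
  shows "j = k * l"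
proof -
  have base: "x \<in> G" "cent x" if "x \<in> base" for x using that by (auto simp: base_def)
  note mem = base[OF assms(1)] base[OF assms(2)] base[OF assms(3)] base[OF a_in_base]
  have L: "log_slope (x \<circ> T i y) m = log_slope x m + log_slope y (m - i)"
    if "x \<in> base" "y \<in> base" for x y i m
    using that base log_slope_comp log_slope_T T_in_G cent_T by metis
  show ?thesis
  proof (rule product_of_moments[OF finite_log_slope[OF mem(7,8)] finite_log_slope[OF mem(1,2)]
        finite_log_slope[OF mem(3,4)] finite_log_slope[OF mem(5,6)]])
    fix i
    show "log_slope a (i - j) + log_slope u i = log_slope a i + log_slope u (i - k)"
      using arg_cong[OF eq(1), of "\<lambda>x. log_slope x i"] assms(1-3) a_in_base by (simp add: L)
    show "log_slope a (i - l) + log_slope s i = log_slope a i + log_slope s (i - 1)"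
      using arg_cong[OF eq(2), of "\<lambda>x. log_slope x i"] assms(1-3) a_in_base by (simp add: L)
    show "log_slope u i + log_slope w i = log_slope s i + log_slope w (i - 1)"
      using arg_cong[OF eq(3), of "\<lambda>x. log_slope x i"] L[of w u 0 i] assms(1-3)
        log_slope_comp[OF mem(3,4) T_in_G[OF mem(5)], of 1 i] log_slope_T[OF mem(5,6), of 1 i] by simp
  next
    have "log_slope a = (\<lambda>i. if i = 0 then log_slope a 0 else 0)"
      by (rule ext) (use log_slope_a(1) in auto)
    then have "Sum_any (log_slope a) = Sum_any (\<lambda>i::int. if i = 0 then log_slope a 0 else 0)"
      by (rule arg_cong)
    also have "\<dots> = log_slope a 0" by (rule Sum_any.delta[where g = "\<lambda>_. log_slope a 0"])
    finally have "Sum_any (log_slope a) = log_slope a 0" .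
    then show "Sum_any (log_slope a) \<noteq> 0" using log_slope_a(2) by simp
  qed
qed

text \<open>The conjugate is a bump on (0, P (-j)). If P (-j) \<le> p its support is disjoint from
  that of \<open>a\<close>. Conversely, commuting with \<open>a\<close> forces it to fix p, the left
  end of the support of \<open>a\<close>, so p cannot lie in (0, P (-j)).\<close>

lemma nonneg_iff: "T (- j) h \<circ> a = a \<circ> T (- j) h \<longleftrightarrow> 0 \<le> j"
proof -
  have "fpow F (- j) 0 = 0"
    by (rule F.fpow_fix_outside) simp
  then have bump: "bump (T (- j) h) 0 (P (- j))"
    using bump_conj[OF h(2) strict_mono_fpow[of "- j"], of "fpow F j"] cancel by (simp add: T_def)
  show ?thesis
  proof
    assume "0 \<le> j"
    then have "P (- j) \<le> p" using P_le[of "- j" 0] by simp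
    from disjoint_bumps_commute[OF bump a(2) this] show "T (- j) h \<circ> a = a \<circ> T (- j) h" .
  next
    assume comm: "T (- j) h \<circ> a = a \<circ> T (- j) h"
    have inG: "T (- j) h \<in> G" using h T_in_G by blast
    obtain l where "right_affine (T (- j) h) p l" using right_affine_at_P[OF inG, of 0] by auto
    then have "T (- j) h p = p" by (rule bump.commuting_fix_left[OF a(2) bij_G[OF inG] comm])
    then have "\<not> p < P (- j)" using bump.moved_iff[OF bump, of p] p by auto
    then show "0 \<le> j" using P_mono[of 0 "- j"] by fastforce
  qed
qed

lemma interprets_arith: "interprets_arith_params G Vmult inv id"
proof -
  define num where "num n = fpow F (int n)" for n
  define cj where "cj = (\<lambda>g x. Vmult (Vmult (inv g) x) g)"
  define Cent where "Cent = (\<lambda>x. \<forall>g\<in>G. Vmult g F = Vmult F g \<longrightarrow> Vmult x (cj g a) = Vmult (cj g a) x)"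
  define Base where "Base = (\<lambda>x. Cent x \<and> (\<forall>y\<in>G. Cent y \<longrightarrow> Vmult x y = Vmult y x))"
  have cj: "cj (fpow F j) x = T j x" for j x by (simp only: cj_def T_eq)
  have cjF: "cj F x = T 1 x" for x using cj[of 1] by simp
  have centralizer': "g \<in> G \<and> Vmult g F = Vmult F g \<longleftrightarrow> g \<in> range (fpow F)" for g
    unfolding centralizer[symmetric] mem_Collect_eq Vmult_def eq_commute[of "F \<circ> g"] ..
  have vcomm: "Vmult x y = Vmult y x \<longleftrightarrow> x \<circ> y = y \<circ> x" for x y
    unfolding Vmult_def by (rule eq_commute)
  have "Cent x \<longleftrightarrow> (\<forall>g\<in>range (fpow F). Vmult x (cj g a) = Vmult (cj g a) x)" for x
    unfolding Cent_def using centralizer' by blast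
  then have Cent: "Cent x \<longleftrightarrow> cent x" for x
    by (simp only: ball_simps ball_UNIV cj vcomm cent_def)
  have Base: "x \<in> G \<and> Base x \<longleftrightarrow> x \<in> base" for x
    unfolding Base_def base_def Cent vcomm mem_Collect_eq ..
  have inj: "inj num"
  proof (rule injI)
    fix m n assume "num m = num n"
    then have "P (int m) = P (int n)" by (simp add: num_def)
    then show "m = n" using P_mono[of "int m" "int n"] P_mono[of "int n" "int m"]
      by (cases m n rule: linorder_cases) auto
  qed
  have nat_iff: "(Vmult y F = Vmult F y \<and> Vmult (cj (inv y) h) a = Vmult a (cj (inv y) h)) \<longleftrightarrow> y \<in> range num"
    if "y \<in> G" for y
  proof -
    have pow: "Vmult (cj (inv (fpow F j)) h) a = Vmult a (cj (inv (fpow F j)) h) \<longleftrightarrow> 0 \<le> j" for j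
      by (simp only: inv_fpow[OF F.bij] cj vcomm nonneg_iff)
    show ?thesis
    proof
      assume L: "Vmult y F = Vmult F y \<and> Vmult (cj (inv y) h) a = Vmult a (cj (inv y) h)"
      then have "y \<in> range (fpow F)" using that centralizer'[of y] by blast
      then obtain j where j: "y = fpow F j" by (rule rangeE)
      then have "0 \<le> j" using L pow[of j] by (simp only:)
      then have "y = num (nat j)" using j by (simp add: num_def)
      then show "y \<in> range num" by blast
    next
      assume "y \<in> range num"
      then obtain n where n: "y = fpow F (int n)" by (auto simp: num_def)
      then show "Vmult y F = Vmult F y \<and> Vmult (cj (inv y) h) a = Vmult a (cj (inv y) h)"
        using centralizer'[of y] pow[of "int n"] by (simp only: rangeI of_nat_0_le_iff simp_thms)
    qed
  qed
  have mult_iff: "(\<exists>u\<in>G. \<exists>s\<in>G. \<exists>w\<in>G. Base u \<and> Base s \<and> Base w \<and>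
       Vmult (cj (num j) a) u = Vmult (cj (num k) u) a \<and> Vmult (cj (num l) a) s = Vmult (cj F s) a \<and>
       Vmult u w = Vmult s (cj F w)) \<longleftrightarrow> j = k * l" for j k l
  proof -
    have "(\<exists>u\<in>G. \<exists>s\<in>G. \<exists>w\<in>G. Base u \<and> Base s \<and> Base w \<and>
       Vmult (cj (num j) a) u = Vmult (cj (num k) u) a \<and> Vmult (cj (num l) a) s = Vmult (cj F s) a \<and>
       Vmult u w = Vmult s (cj F w)) \<longleftrightarrow> (\<exists>u\<in>base. \<exists>s\<in>base. \<exists>w\<in>base.
       u \<circ> A (int j) = a \<circ> T (int k) u \<and> s \<circ> A (int l) = a \<circ> T 1 s \<and> w \<circ> u = T 1 w \<circ> s)"
      unfolding num_def cj cjF Vmult_def Bex_def Base[symmetric] by blast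
    also have "\<dots> \<longleftrightarrow> j = k * l"
    proof
      assume "\<exists>u\<in>base. \<exists>s\<in>base. \<exists>w\<in>base.
       u \<circ> A (int j) = a \<circ> T (int k) u \<and> s \<circ> A (int l) = a \<circ> T 1 s \<and> w \<circ> u = T 1 w \<circ> s"
      then have "int j = int k * int l" using product_if_witness by blast
      then show "j = k * l" by (simp flip: of_nat_mult)
    next
      assume "j = k * l"
      then show "\<exists>u\<in>base. \<exists>s\<in>base. \<exists>w\<in>base.
       u \<circ> A (int j) = a \<circ> T (int k) u \<and> s \<circ> A (int l) = a \<circ> T 1 s \<and> w \<circ> u = T 1 w \<circ> s"
        using base.product_witness[OF a_in_base, of k l] by (simp only:)
    qed
    finally show ?thesis .
  qed
  have add: "num (k + l) = Vmult (num k) (num l)" for k l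
    unfolding num_def Vmult_def by (simp only: of_nat_add add.commute[of "int k"] fpow_add[OF F.bij])
  have num_G: "num n \<in> G" for n by (simp only: num_def fpow_in_G)
  interpret coded_naturals G Vmult inv id F a h num cj Cent Base
    by unfold_locales
       (fact F_in_G a(1) h(1) num_G inj add nat_iff[unfolded cj_def] mult_iff[unfolded Base_def Cent_def cj_def]
          cj_def[THEN eq_reflection] Cent_def[THEN eq_reflection] Base_def[THEN eq_reflection])+
  show ?thesis by (rule interprets_arith)
qed

end

section \<open>Choice of the bumps in \<open>G\<close> and assembly of the interpretation\<close>

theorem theoremA:
  fixes r :: real and \<Lambda> A :: "real set" and G :: "(real \<Rightarrow> real) set"
  assumes "admissible r \<Lambda> A"
    and "\<Lambda> \<noteq> {1}"
    and "is_subgroup_of G (Vset r {0<..} UNIV)"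
    and "G \<inter> Fset r {0<..} UNIV = Fset r \<Lambda> A"
  shows "interprets_arith_params G Vmult inv id"
proof -
  have A: "0 < r" "r \<in> A" "0 \<in> A" and \<Lambda>: "\<Lambda> \<subseteq> {0<..}" "1 \<in> \<Lambda>" "\<And>l. l \<in> \<Lambda> \<Longrightarrow> inverse l \<in> \<Lambda>"
    using assms(1) by (auto simp: admissible_def mult_subgroup_def add_subgroup_def)
  obtain l where l: "l \<in> \<Lambda>" "l \<noteq> 1" using assms(2) \<Lambda>(2) by blast
  obtain \<kappa> where \<kappa>: "\<kappa> \<in> \<Lambda>" "1 < \<kappa>"
  proof (cases "1 < l")
    case True
    with l that show ?thesis by blast
  next
    case False
    moreover have "0 < l" using l \<Lambda>(1) by auto
    ultimately have "1 < inverse l" using l by (simp add: one_less_inverse_iff)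
    then show ?thesis using that \<Lambda>(3)[OF l(1)] by blast
  qed
  have G: "id \<in> G" "x \<in> G \<Longrightarrow> y \<in> G \<Longrightarrow> x \<circ> y \<in> G" "x \<in> G \<Longrightarrow> inv x \<in> G" for x y
    using assms(3) by (auto simp: is_subgroup_of_def Vmult_def)
  have V: "x \<in> Vset r {0<..} UNIV" if "x \<in> G" for x
    using assms(3) that by (auto simp: is_subgroup_of_def)
  have F_sub: "Fset r \<Lambda> A \<subseteq> G" using assms(4) by blast
  obtain u where u: "u \<in> A" "standard_bump \<kappa> 0 r u"
    using exists_standard_bump[OF assms(1) \<kappa> A(3,2,1)] .
  interpret f: standard_bump \<kappa> 0 r u by (rule u(2))
  define f where "f = std_bump \<kappa> 0 r u"
  have f: "f \<in> G" using f.in_Fset[OF assms(1) \<kappa>(1) A(3,2) u(1)] F_sub by (auto simp: f_def)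
  define H where "H = {g \<in> G. g \<circ> f = f \<circ> g}"
  obtain F where F: "bump F 0 r" "H = range (fpow F)" "\<exists>j. F u = fpow f j u \<or> F u = fpow f j (r - \<kappa> * u)"
  proof (rule f.cyclic_centralizer[of H, folded f_def])
    fix g assume "g \<in> H"
    then have g: "g \<in> G" "g \<circ> f = f \<circ> g" by (auto simp: H_def)
    obtain m where m: "right_affine g 0 m" using Vset_right_affine[OF V[OF g(1)], of 0] A(1) by auto
    \<comment> \<open>The extension convention fixes only points outside [0,r), so 0 needs an
      argument: it is the left end of the support of f.\<close>
    have "g 0 = 0" by (rule f.commuting_fix_left[OF Vset_bij[OF V[OF g(1)]] g(2)[unfolded f_def] m])
    then have "g t = t" if "t \<notin> {0<..<r}" for t
      using Vset_outside[OF V[OF g(1)], of t] that by (cases "t = 0") auto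
    then show "bij g \<and> g \<circ> f = f \<circ> g \<and> (\<exists>l. right_affine g 0 l) \<and> left_affine g r \<and>
        (\<forall>t. t \<notin> {0<..<r} \<longrightarrow> g t = t)"
      using Vset_bij[OF V[OF g(1)]] g(2) m Vset_left_affine[OF V[OF g(1)]] by blast
  next
    show "f \<in> H" using f by (simp add: H_def)
  next
    fix g k assume "g \<in> H" "k \<in> H"
    then have "g \<in> G" "k \<in> G" "g \<circ> f = f \<circ> g" "k \<circ> f = f \<circ> k" by (auto simp: H_def)
    then show "g \<circ> k \<in> H" unfolding H_def using G(2) by (metis (mono_tags, lifting) comp_assoc mem_Collect_eq)
  next
    fix g assume "g \<in> H"
    then have g: "g \<in> G" "bij g" "g \<circ> f = f \<circ> g" using Vset_bij[OF V] by (auto simp: H_def)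
    have "inv g (f t) = f (inv g t)" for t
    proof -
      have "g (f (inv g t)) = f t"
        using fun_cong[OF g(3), of "inv g t"] g(2) by (simp add: bij_def surj_f_inv_f)
      then show ?thesis using g(2) by (metis bij_inv_eq_iff)
    qed
    then show "inv g \<in> H" using G(3)[OF g(1)] by (simp add: H_def fun_eq_iff)
  qed (use that in auto)
  interpret F: bump F 0 r by (rule F(1))
  \<comment> \<open>The map f is a power of \<open>F\<close>, so commuting with \<open>F\<close>
    implies commuting with f. Hence \<open>F\<close> has the same centralizer as f and can replace
    it as the parameter.\<close>
  have centralizer: "{x \<in> G. x \<circ> F = F \<circ> x} = range (fpow F)"
  proof (intro equalityI subsetI)
    fix x assume x: "x \<in> {x \<in> G. x \<circ> F = F \<circ> x}"
    have "f \<in> range (fpow F)" using f F(2) by (auto simp: H_def)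
    then obtain j where "f = fpow F j" by blast
    then have "x \<circ> f = f \<circ> x" using fpow_commutes[OF F.bij] x by blast
    then show "x \<in> range (fpow F)" using x F(2) by (auto simp: H_def)
  next
    fix x assume x: "x \<in> range (fpow F)"
    then obtain j where "x = fpow F j" by blast
    then have "x \<circ> F = F \<circ> x" using fpow_commute[OF F.bij, of j 1] by simp
    moreover have "x \<in> G" using x F(2) by (auto simp: H_def)
    ultimately show "x \<in> {x \<in> G. x \<circ> F = F \<circ> x}" by simp
  qed
  have p: "u \<in> {0<..<r}" using f.cuts by auto
  \<comment> \<open>The next bumps need endpoints in A. The point F u lies in the f-orbit of one of
    the kinks u and r - \<open>\<kappa>\<close> u, which both belong to A.\<close>
  have "F u \<in> A"
  proof -
    have "r - \<kappa> * u \<in> A"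
    proof -
      have "\<kappa> * u \<in> A" "\<And>b. b \<in> A \<Longrightarrow> - b \<in> A" "\<And>b c. b \<in> A \<Longrightarrow> c \<in> A \<Longrightarrow> b + c \<in> A"
        using assms(1) \<kappa>(1) u(1) by (auto simp: admissible_def add_subgroup_def)
      from this(3)[OF A(2) this(2)[OF this(1)]] show ?thesis by simp
    qed
    then show ?thesis
      using F(3) f.orbit_in_module[OF assms(1) \<kappa>(1) A(3,2) u(1)] u(1) unfolding f_def by metis
  qed
  have uF: "u < F u" "F u < r" using F.up[OF p] F.mem_iff[of u] p by auto
  \<comment> \<open>The kink u serves as p: one bump is placed on (u, F u) and one on (0, u). Both
    lie in F(r,\<open>\<Lambda>\<close>,A), which is how they are known to belong to
    \<open>G\<close>.\<close>
  obtain v where v: "v \<in> A" "standard_bump \<kappa> u (F u) v"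
    using exists_standard_bump[OF assms(1) \<kappa> u(1) \<open>F u \<in> A\<close> uF(1)] .
  obtain w where w: "w \<in> A" "standard_bump \<kappa> 0 u w"
    using exists_standard_bump[OF assms(1) \<kappa> A(3) u(1)] p by auto
  interpret a: standard_bump \<kappa> u "F u" v by (rule v(2))
  interpret h: standard_bump \<kappa> 0 u w by (rule w(2))
  have "a.X \<in> G" "h.X \<in> G"
    using a.in_Fset[OF assms(1) \<kappa>(1) u(1) \<open>F u \<in> A\<close> v(1)] h.in_Fset[OF assms(1) \<kappa>(1) A(3) u(1) w(1)]
      p uF F_sub by auto
  then interpret thompson_coding G r u F a.X h.X
    by unfold_locales
       (use G Vset_bij[OF V] Vset_right_affine[OF V] Vset_left_affine[OF V] F.bump_axioms centralizer p
          a.bump_axioms h.bump_axioms in \<open>blast+\<close>)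
  show ?thesis by (rule interprets_arith)
qed

end
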